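(* Let $\ell>0$ and let $f\in W^{1,2}(0,\ell)$ be complex-valued with $f(x)\neq0$ for all $x\in[0,\ell]$ and $f(0)=1$. Then $\mathbf{T}_f(C[-\ell,\ell])\subset C[0,\ell]$. Furthermore, $\mathbf{T}_f$ is a bounded linear operator from $C[-\ell,\ell]$ to $C[0,\ell]$ (with the sup norms).
   Context: All functions are complex-valued. $\mathcal{T}_\ell=\{(x,t): 0\le x\le\ell,\ |t|\le x\}$. $\mathbf{D}_f y:=f(y/f)'=y'-\frac{f'}{f}y$, $\mathbf{D}_{\frac1f}y:=\frac1f(fy)'=y'+\frac{f'}{f}y$. $\mathbf{S}_f$ is the Schrödinger operator $-y''+q_fy$ on $(0,\ell)$ with distributional potential $q_f=f''/f\in W^{-1,2}(0,\ell)$; its domain is $\mathscr{D}_2(\mathbf{S}_f)=\{y\in W^{1,2}(0,\ell):\mathbf{D}_fy\in W^{1,2}(0,\ell)\}$ and there $\mathbf{S}_fy=-\mathbf{D}_{\frac1f}\mathbf{D}_fy\in L^2(0,\ell)$. For $\rho\in\mathbb{C}$, $e_f(\rho,\cdot)\in\mathscr{D}_2(\mathbf{S}_f)$ is the unique solution of $\mathbf{S}_fy=\rho^2y$ with $y(0)=1$, $\mathbf{D}_fy(0)=i\rho$. $K_f\in L^2(\mathcal{T}_\ell)$ is the kernel with $K_f(x,\cdot)\in L^2(-x,x)$ and $e_f(\rho,x)=e^{i\rho x}+\int_{-x}^xK_f(x,t)e^{i\rho t}dt$ for all $\rho\in\mathbb{C}$, $x\in(0,\ell]$ (such a kernel exists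 and is unique up to null sets). The operator $\mathbf{T}_f:L^2(-\ell,\ell)\to L^2(0,\ell)$ is $\mathbf{T}_fy(x)=y(x)+\int_{-x}^xK_f(x,t)y(t)\,dt$. *)

theory Defs
  imports "HOL-Analysis.Analysis"
begin

definition L2_on :: "'a::euclidean_space set \<Rightarrow> ('a \<Rightarrow> complex) \<Rightarrow> bool" where
  "L2_on S h \<longleftrightarrow> set_borel_measurable lebesgue S h \<and>
     set_integrable lebesgue S (\<lambda>x. (norm (h x))\<^sup>2)"

text \<open>Weak derivatives on \<open>(0,l)\<close> are tested against \<open>C\<^sup>1\<close> functions with compact support in
  \<open>(0,l)\<close>, as in Brezis, Functional Analysis, Sobolev Spaces and PDEs, chapter 8; restricting to
  smooth test functions defines the same space. A subset of \<open>(0,l)\<close>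
  that is closed in the reals is compact.\<close>

definition test_function :: "real \<Rightarrow> (real \<Rightarrow> complex) \<Rightarrow> (real \<Rightarrow> complex) \<Rightarrow> bool" where
  "test_function l \<phi> \<phi>' \<longleftrightarrow> (\<forall>x. (\<phi> has_vector_derivative \<phi>' x) (at x)) \<and>
     continuous_on UNIV \<phi>' \<and> closure {x. \<phi> x \<noteq> 0} \<subseteq> {0<..<l}"

definition weak_derivative :: "real \<Rightarrow> (real \<Rightarrow> complex) \<Rightarrow> (real \<Rightarrow> complex) \<Rightarrow> bool" where
  "weak_derivative l y g \<longleftrightarrow> L2_on {0<..<l} g \<and>
     (\<forall>\<phi> \<phi>'. test_function l \<phi> \<phi>' \<longrightarrow>
        (LINT x:{0<..<l}|lebesgue. y x * \<phi>' x) = - (LINT x:{0<..<l}|lebesgue. g x * \<phi> x))"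

text \<open>An element of the Sobolev space \<open>W\<^sup>1\<^sup>,\<^sup>2(0,l)\<close> is represented by its continuous representative
  on \<open>[0,l]\<close>, which gives the values \<open>y 0\<close> and \<open>f x\<close> their meaning. Values outside \<open>[0,l]\<close> are
  irrelevant.\<close>

definition W12 :: "real \<Rightarrow> (real \<Rightarrow> complex) set" where
  "W12 l = {y. continuous_on {0..l} y \<and> L2_on {0<..<l} y \<and> (\<exists>g. weak_derivative l y g)}"

text \<open>The weak derivative is unique almost everywhere on \<open>(0,l)\<close>.\<close>

definition wderiv :: "real \<Rightarrow> (real \<Rightarrow> complex) \<Rightarrow> real \<Rightarrow> complex" where
  "wderiv l y = (SOME g. weak_derivative l y g)"

definition ae_eq :: "real \<Rightarrow> (real \<Rightarrow> complex) \<Rightarrow> (real \<Rightarrow> complex) \<Rightarrow> bool" where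
  "ae_eq l g h \<longleftrightarrow> (AE x in lebesgue. x \<in> {0<..<l} \<longrightarrow> g x = h x)"

text \<open>\<open>D_f l f y\<close> is \<open>y' - (f'/f) y\<close> and \<open>D_inv l f z\<close> is \<open>z' + (f'/f) z\<close>, as classes modulo
  equality almost everywhere on \<open>(0,l)\<close>.\<close>

definition D_f :: "real \<Rightarrow> (real \<Rightarrow> complex) \<Rightarrow> (real \<Rightarrow> complex) \<Rightarrow> real \<Rightarrow> complex" where
  "D_f l f y x = wderiv l y x - wderiv l f x / f x * y x"

definition D_inv :: "real \<Rightarrow> (real \<Rightarrow> complex) \<Rightarrow> (real \<Rightarrow> complex) \<Rightarrow> real \<Rightarrow> complex" where
  "D_inv l f z x = wderiv l z x + wderiv l f x / f x * z x"

definition dom_S :: "real \<Rightarrow> (real \<Rightarrow> complex) \<Rightarrow> (real \<Rightarrow> complex) set" where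
  "dom_S l f = {y \<in> W12 l. \<exists>z\<in>W12 l. ae_eq l z (D_f l f y)}"

text \<open>For \<open>y \<in> dom_S l f\<close>: the continuous representative of the class of \<open>D_f l f y\<close>, unique
  on \<open>[0,l]\<close> for \<open>l > 0\<close>.\<close>

definition D_rep :: "real \<Rightarrow> (real \<Rightarrow> complex) \<Rightarrow> (real \<Rightarrow> complex) \<Rightarrow> real \<Rightarrow> complex" where
  "D_rep l f y = (SOME z. z \<in> W12 l \<and> ae_eq l z (D_f l f y))"

definition S_f :: "real \<Rightarrow> (real \<Rightarrow> complex) \<Rightarrow> (real \<Rightarrow> complex) \<Rightarrow> real \<Rightarrow> complex" where
  "S_f l f y x = - D_inv l f (D_rep l f y) x"

definition is_e_f :: "real \<Rightarrow> (real \<Rightarrow> complex) \<Rightarrow> complex \<Rightarrow> (real \<Rightarrow> complex) \<Rightarrow> bool" where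
  "is_e_f l f \<rho> y \<longleftrightarrow> y \<in> dom_S l f \<and> ae_eq l (S_f l f y) (\<lambda>x. \<rho>\<^sup>2 * y x) \<and>
     y 0 = 1 \<and> D_rep l f y 0 = \<i> * \<rho>"

definition triangle :: "real \<Rightarrow> (real \<times> real) set" where
  "triangle l = {(x, t). 0 \<le> x \<and> x \<le> l \<and> \<bar>t\<bar> \<le> x}"

definition transmutation_kernel ::
  "real \<Rightarrow> (complex \<Rightarrow> real \<Rightarrow> complex) \<Rightarrow> (real \<Rightarrow> real \<Rightarrow> complex) \<Rightarrow> bool" where
  "transmutation_kernel l e K \<longleftrightarrow> L2_on (triangle l) (\<lambda>(x, t). K x t) \<and>
     (\<forall>x\<in>{0<..l}. L2_on {-x<..<x} (K x)) \<and>
     (\<forall>\<rho>. \<forall>x\<in>{0<..l}. e \<rho> x = exp (\<i> * \<rho> * of_real x) +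
        (LINT t:{-x..x}|lebesgue. K x t * exp (\<i> * \<rho> * of_real t)))"

definition T_f :: "(real \<Rightarrow> real \<Rightarrow> complex) \<Rightarrow> (real \<Rightarrow> complex) \<Rightarrow> real \<Rightarrow> complex" where
  "T_f K y x = y x + (LINT t:{-x..x}|lebesgue. K x t * y t)"

text \<open>Elements of \<open>C[a,b]\<close> are functions on the reals of which only the values on \<open>[a,b]\<close>
  matter.\<close>

definition C_on :: "real \<Rightarrow> real \<Rightarrow> (real \<Rightarrow> complex) set" where
  "C_on a b = {y. continuous_on {a..b} y}"

definition sup_norm :: "real \<Rightarrow> real \<Rightarrow> (real \<Rightarrow> complex) \<Rightarrow> real" where
  "sup_norm a b y = (SUP x\<in>{a..b}. norm (y x))"

end

theory Submission
  imports Defs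
begin

text \<open>Write \<open>y = e_f(\<rho>,\<cdot>)\<close>, \<open>z = D_f y\<close>, \<open>\<sigma> = f'/f\<close>. For \<open>\<rho> \<noteq> 0\<close> the functions
  \<open>u = (y + z/(i\<rho>))/2\<close> and \<open>v = (y - z/(i\<rho>))/2\<close> satisfy \<open>u' = i\<rho> u + \<sigma> v\<close>, \<open>v' = -i\<rho> v + \<sigma> u\<close>, so that
  \<open>U(x,t) = u(x) exp(i\<rho>t)\<close> and \<open>V(x,t) = v(x) exp(i\<rho>t)\<close> solve
  \<open>U(x,t) = p(x+t) + \<integral>\<^sub>0\<^sup>x \<sigma>(s) V(s,t+x-s) ds\<close>, \<open>V(x,t) = \<integral>\<^sub>0\<^sup>x \<sigma>(s) U(s,t-x+s) ds\<close>
  with \<open>p(t) = exp(i\<rho>t)\<close>, and \<open>T_f p (x) = y(x) = U(x,0) + V(x,0)\<close>. This system is linear in \<open>p\<close> and does not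
  contain \<open>\<rho>\<close>; since \<open>\<sigma> \<in> L\<^sup>2\<close>, it is a contraction in a sup norm with exponential weight, whence
  \<open>|U|, |V| \<le> C sup |p|\<close>. So \<open>T_f\<close> is bounded from sup norm to sup norm on the span of the exponentials with real
  nonzero frequency, and maps it to continuous functions. That span is dense in \<open>C[-l,l]\<close>, and
  \<open>p \<mapsto> T_f p (x)\<close> is continuous on \<open>C[-l,l]\<close> for each \<open>x\<close> because \<open>K(x,\<cdot>)\<close> is integrable.\<close>

section \<open>Step functions as test functions and approximate identities\<close>

text \<open>A \<open>C\<^sup>1\<close> step from 0 to 1 on \<open>[0,1]\<close>: the integral of the tent function \<open>step'\<close>.\<close>

definition step :: "real \<Rightarrow> real" where
  "step t = 2 * (max 0 t)\<^sup>2 - 4 * (max 0 (t - 1/2))\<^sup>2 + 2 * (max 0 (t - 1))\<^sup>2"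

definition step' :: "real \<Rightarrow> real" where
  "step' t = 4 * max 0 t - 8 * max 0 (t - 1/2) + 4 * max 0 (t - 1)"

lemma DERIV_pos_part_square: "((\<lambda>t::real. (max 0 t)\<^sup>2) has_real_derivative 2 * max 0 t) (at t)"
proof -
  consider "t < 0" | "t = 0" | "t > 0" by linarith
  then show ?thesis
  proof cases
    case 1
    have "((\<lambda>t::real. 0) has_real_derivative 2 * max 0 t) (at t)" using 1 by simp
    then show ?thesis
      by (rule has_field_derivative_transform_within_open[of _ _ _ "{..<0}"]) (use 1 in auto)
  next
    case 3
    have "((\<lambda>t::real. t\<^sup>2) has_real_derivative 2 * max 0 t) (at t)"
      using 3 by (auto intro!: derivative_eq_intros)
    then show ?thesis
      by (rule has_field_derivative_transform_within_open[of _ _ _ "{0<..}"]) (use 3 in auto)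
  next
    case 2
    \<comment> \<open>At the gluing point the difference quotient is either 0 or \<open>h\<close>,
      so it tends to 0 with \<open>h\<close>.\<close>
    have "((\<lambda>h::real. (max 0 h)\<^sup>2 / h) \<longlongrightarrow> 0) (at 0)"
    proof (rule Lim_null_comparison)
      show "((\<lambda>h::real. \<bar>h\<bar>) \<longlongrightarrow> 0) (at 0)" by (rule tendsto_rabs_zero) simp
      show "\<forall>\<^sub>F h::real in at 0. norm ((max 0 h)\<^sup>2 / h) \<le> \<bar>h\<bar>"
        by (rule always_eventually) (auto simp: max_def power2_eq_square)
    qed
    then show ?thesis using 2 by (simp add: DERIV_def)
  qed
qed

lemma DERIV_step: "(step has_real_derivative step' t) (at t)"
proof -
  have *: "((\<lambda>t::real. (max 0 (t - c))\<^sup>2) has_real_derivative 2 * max 0 (t - c)) (at t)" for c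
    by (rule DERIV_cong[OF DERIV_chain2[OF DERIV_pos_part_square]])
       (auto intro!: derivative_eq_intros)
  have **: "((\<lambda>t::real. (max 0 t)\<^sup>2) has_real_derivative 2 * max 0 t) (at t)"
    by (rule DERIV_pos_part_square)
  show ?thesis
    unfolding step_def[abs_def] step'_def
    by (rule derivative_eq_intros * ** refl | simp)+
qed

lemma continuous_step': "continuous_on A step'"
  unfolding step'_def[abs_def] by (intro continuous_intros)

lemma step_eq_0: "t \<le> 0 \<Longrightarrow> step t = 0"
  and step_eq_1: "t \<ge> 1 \<Longrightarrow> step t = 1"
  by (auto simp: step_def max_def power2_eq_square algebra_simps)

lemma step'_nonneg: "step' t \<ge> 0"
  and step'_eq_0: "t \<le> 0 \<or> t \<ge> 1 \<Longrightarrow> step' t = 0"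
  by (auto simp: step'_def max_def)

lemma step_bounds: "0 \<le> step t" "step t \<le> 1"
proof -
  have mono: "step a \<le> step b" if "a \<le> b" for a b
    by (rule DERIV_nonneg_imp_nondecreasing[OF that]) (use DERIV_step step'_nonneg in blast)
  show "0 \<le> step t" using mono[of "min 0 t" t] step_eq_0[of "min 0 t"] by simp
  show "step t \<le> 1" using mono[of t "max 1 t"] step_eq_1[of "max 1 t"] by simp
qed

lemma DERIV_step_scaled:
  "((\<lambda>s. step (r * (s - \<alpha>))) has_real_derivative r * step' (r * (s - \<alpha>))) (at s within A)"
  by (rule DERIV_subset[OF _ subset_UNIV], rule DERIV_cong[OF DERIV_chain2[OF DERIV_step]])
     (auto intro!: derivative_eq_intros)

text \<open>The scaled tent is nonnegative, has integral 1 and lives on an interval of length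
  \<open>1 / real n\<close> starting at \<open>\<alpha> n\<close>, so it is an approximate identity
  at \<open>c\<close>. Assumption \<open>ev\<close> keeps that interval inside
  \<open>{0..l}\<close>, so that no mass is lost when \<open>c\<close> is an endpoint.\<close>

lemma step_approximates_evaluation:
  fixes y :: "real \<Rightarrow> complex"
  assumes y: "continuous_on {0..l} y" and c: "c \<in> {0..l}"
    and \<alpha>: "\<alpha> \<longlonglongrightarrow> c" and ev: "\<forall>\<^sub>F n in sequentially. 0 \<le> \<alpha> n \<and> \<alpha> n + 1 / real n \<le> l"
  shows "(\<lambda>n. integral {0..l} (\<lambda>s. y s * of_real (real n * step' (real n * (s - \<alpha> n)))))
    \<longlonglongrightarrow> y c"
proof (rule tendstoI)
  fix \<epsilon> :: real assume "\<epsilon> > 0"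
  then have e2: "\<epsilon>/2 > 0" by simp
  from y c e2 obtain d where d: "d > 0" "\<And>s. s \<in> {0..l} \<Longrightarrow> dist s c < d \<Longrightarrow> dist (y s) (y c) < \<epsilon>/2"
    unfolding continuous_on_iff by blast
  have "(\<lambda>n. 1 / real n) \<longlonglongrightarrow> 0" by (rule lim_1_over_n)
  then have "\<forall>\<^sub>F n in sequentially. dist (1 / real n) 0 < d/2" using d(1) by (intro tendstoD) auto
  moreover have "\<forall>\<^sub>F n in sequentially. dist (\<alpha> n) c < d/2" using \<alpha> d(1) by (intro tendstoD) auto
  moreover have "\<forall>\<^sub>F n in sequentially. n > (0::nat)" by (rule eventually_gt_at_top)
  ultimately show "\<forall>\<^sub>F n in sequentially. dist (integral {0..l}
      (\<lambda>s. y s * of_real (real n * step' (real n * (s - \<alpha> n))))) (y c) < \<epsilon>"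
    using ev
  proof eventually_elim
    case (elim n)
    define k where "k s = real n * step' (real n * (s - \<alpha> n))" for s
    have n: "real n > 0" using elim by simp
    have l0: "0 \<le> l" using c by simp
    have kc: "continuous_on {0..l} k"
      unfolding k_def by (intro continuous_intros continuous_on_compose2[OF continuous_step'[of UNIV]]) auto
    have "(k has_integral step (real n * (l - \<alpha> n)) - step (real n * (0 - \<alpha> n))) {0..l}"
      unfolding k_def using l0
      by (intro fundamental_theorem_of_calculus)
         (auto simp: has_real_derivative_iff_has_vector_derivative[symmetric] intro!: DERIV_step_scaled)
    moreover have "step (real n * (0 - \<alpha> n)) = 0" using elim n by (intro step_eq_0) (simp add: mult_nonneg_nonneg)
    moreover have "step (real n * (l - \<alpha> n)) = 1" using elim n by (intro step_eq_1) (simp add: field_simps)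
    ultimately have kI: "(k has_integral 1) {0..l}" by simp
    have kI': "((\<lambda>s. y c * of_real (k s)) has_integral y c * 1) {0..l}"
      using has_integral_mult_right[OF has_integral_of_real[OF kI], of "y c"] by simp
    have ik: "k integrable_on {0..l}" using kI by blast
    have yk: "(\<lambda>s. y s * of_real (k s)) integrable_on {0..l}"
      by (intro integrable_continuous_interval continuous_intros y kc)
    have "integral {0..l} (\<lambda>s. y s * of_real (k s)) - y c
      = integral {0..l} (\<lambda>s. y s * of_real (k s) - y c * of_real (k s))"
      using integral_diff[OF yk has_integral_integrable[OF kI']] integral_unique[OF kI'] by simp
    also have "norm \<dots> \<le> integral {0..l} (\<lambda>s. \<epsilon>/2 * k s)"
    proof (rule integral_norm_bound_integral)
      show "(\<lambda>s. y s * of_real (k s) - y c * of_real (k s)) integrable_on {0..l}"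
        using integrable_diff[OF yk has_integral_integrable[OF kI']] .
      show "(\<lambda>s. \<epsilon>/2 * k s) integrable_on {0..l}" using ik by (rule integrable_on_mult_right)
      fix s assume s: "s \<in> {0..l}"
      have k0: "k s \<ge> 0" unfolding k_def using n step'_nonneg by simp
      have "norm (y s - y c) * k s \<le> \<epsilon>/2 * k s"
      \<comment> \<open>The support of \<open>k\<close> lies within \<open>d\<close> of
        \<open>c\<close>: its left end is \<open>d/2\<close>-close to \<open>c\<close> and its
        length is below \<open>d/2\<close>.\<close>
      proof (cases "\<alpha> n \<le> s \<and> s \<le> \<alpha> n + 1 / real n")
        case True
        have "1 / real n < d/2" "\<bar>\<alpha> n - c\<bar> < d/2"
          using elim(1,2) by (simp_all add: dist_real_def)
        with True have "dist s c < d" unfolding dist_real_def by linarith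
        then have "norm (y s - y c) \<le> \<epsilon>/2" using d(2)[OF s] by (simp add: dist_norm)
        then show ?thesis using k0 by (rule mult_right_mono)
      next
        case False
        then have "real n * (s - \<alpha> n) \<le> 0 \<or> real n * (s - \<alpha> n) \<ge> 1"
          using n by (auto simp: field_simps mult_le_0_iff)
        then have "k s = 0" unfolding k_def by (simp add: step'_eq_0)
        then show ?thesis by simp
      qed
      then show "norm (y s * of_real (k s) - y c * of_real (k s)) \<le> \<epsilon>/2 * k s"
        using k0 by (simp add: left_diff_distrib[symmetric] norm_mult)
    qed
    also have "\<dots> = \<epsilon>/2" using integral_unique[OF kI] by simp
    finally show ?case using \<open>\<epsilon> > 0\<close> by (simp add: dist_norm k_def)
  qed
qed

section \<open>Fundamental theorem of calculus for weak derivatives\<close>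

text \<open>Tested with \<open>C\<^sup>1\<close> approximations of the indicator function of \<open>(0,x)\<close>.\<close>

lemma weak_derivative_FTC:
  fixes y g :: "real \<Rightarrow> complex"
  assumes y: "continuous_on {0..l} y" and g: "set_integrable lebesgue {0<..<l} g"
    and weak: "\<And>\<phi> \<phi>'. test_function l \<phi> \<phi>' \<Longrightarrow>
      (LINT x:{0<..<l}|lebesgue. y x * \<phi>' x) = - (LINT x:{0<..<l}|lebesgue. g x * \<phi> x)"
    and x: "x \<in> {0..l}"
  shows "y x - y 0 = (LINT s:{0<..<x}|lebesgue. g s)"
proof (cases "x = 0")
  case True
  then show ?thesis by (simp add: set_lebesgue_integral_def)
next
  case False
  with x have x0: "x > 0" "x \<le> l" by auto
  \<comment> \<open>The first term climbs on [1/n, 2/n], the second on [x - 2/n, x - 1/n]. The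
    margins of width 1/n keep the support compact in (0,l), even for \<open>x = l\<close>.\<close>
  define \<phi> where "\<phi> n s = step (real n * (s - 1 / real n)) - step (real n * (s - (x - 2 / real n)))" for n s
  define \<phi>' where "\<phi>' n s = real n * step' (real n * (s - 1 / real n)) -
    real n * step' (real n * (s - (x - 2 / real n)))" for n s
  have d\<phi>: "(\<phi> n has_real_derivative \<phi>' n s) (at s)" for n s
    unfolding \<phi>_def \<phi>'_def by (intro DERIV_diff DERIV_step_scaled)
  have c\<phi>: "continuous_on UNIV (\<phi> n)" for n
    using d\<phi> by (meson DERIV_isCont continuous_at_imp_continuous_on)
  have c\<phi>': "continuous_on A (\<phi>' n)" for n A
    unfolding \<phi>'_def by (intro continuous_intros continuous_on_compose2[OF continuous_step'[of UNIV]]) auto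
  have lim1: "(\<lambda>n. c / real n) \<longlonglongrightarrow> 0" for c :: real
    by (rule lim_const_over_n)
  \<comment> \<open>From 3/n <= x the first ramp starts no later than the second; the two may
    overlap.\<close>
  have large: "\<forall>\<^sub>F n in sequentially. n > 0 \<and> 3 / real n \<le> x"
  proof -
    have "\<forall>\<^sub>F n in sequentially. 3 / real n < x" using order_tendstoD(2)[OF lim1 x0(1)] .
    with eventually_gt_at_top[of 0] show ?thesis by eventually_elim auto
  qed
  have test: "test_function l (\<lambda>s. of_real (\<phi> n s)) (\<lambda>s. of_real (\<phi>' n s))"
    if n: "n > 0" "3 / real n \<le> x" for n
  proof -
    have rn: "real n > 0" using n by simp
    have le: "1 / real n \<le> x - 2 / real n" "1 / real n > 0" "2 / real n = 1/ real n + 1 / real n"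
      using n by (simp_all add: field_simps)
    have zero: "\<phi> n s = 0" if "s \<notin> {1 / real n..x - 1 / real n}" for s
    proof -
      consider "s \<le> 1 / real n" | "s \<ge> x - 1 / real n" using \<open>s \<notin> _\<close> by fastforce
      then show ?thesis
      proof cases
        case 1
        then have "real n * (s - 1 / real n) \<le> 0" "real n * (s - (x - 2 / real n)) \<le> 0"
          using le rn by (intro mult_nonneg_nonpos; linarith)+
        then show ?thesis by (simp add: \<phi>_def step_eq_0)
      next
        case 2
        then have "s - 1 / real n \<ge> 1 / real n" "s - (x - 2 / real n) \<ge> 1 / real n"
          using le by linarith+
        then have "real n * (s - 1 / real n) \<ge> 1" "real n * (s - (x - 2 / real n)) \<ge> 1"
          using rn by (simp_all add: pos_divide_le_eq mult.commute)
        then show ?thesis by (simp add: \<phi>_def step_eq_1)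
      qed
    qed
    have "{s. complex_of_real (\<phi> n s) \<noteq> 0} \<subseteq> {1 / real n..x - 1 / real n}"
      by (rule subsetI, rule ccontr) (simp add: zero del: atLeastAtMost_iff)
    then have "closure {s. complex_of_real (\<phi> n s) \<noteq> 0} \<subseteq> {1 / real n..x - 1 / real n}"
      by (intro closure_minimal) auto
    also have "\<dots> \<subseteq> {0<..<l}"
    proof
      fix s assume "s \<in> {1 / real n..x - 1 / real n}"
      then have "1 / real n \<le> s" "s \<le> x - 1 / real n" by (simp_all only: atLeastAtMost_iff)
      then have "0 < s" "s < l" using le(2) x0(2) by linarith+
      then show "s \<in> {0<..<l}" by simp
    qed
    finally show ?thesis unfolding test_function_def
      using d\<phi> c\<phi>' by (auto intro!: continuous_intros has_vector_derivative_of_real)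
  qed
  \<comment> \<open>The derivative side: \<open>\<phi>' n\<close> is an approximate identity at 0
    minus one at \<open>x\<close>.\<close>
  have "(\<lambda>n. LINT s:{0<..<l}|lebesgue. y s * of_real (\<phi>' n s)) \<longlonglongrightarrow> y 0 - y x"
  proof -
    have ci: "(\<lambda>s. y s * of_real (real n * step' (real n * (s - a)))) integrable_on {0..l}" for n a
      by (intro integrable_continuous_interval continuous_intros y
          continuous_on_compose2[OF continuous_step'[of UNIV]]) auto
    have eq: "(LINT s:{0<..<l}|lebesgue. y s * of_real (\<phi>' n s)) =
      integral {0..l} (\<lambda>s. y s * of_real (real n * step' (real n * (s - 1 / real n)))) -
      integral {0..l} (\<lambda>s. y s * of_real (real n * step' (real n * (s - (x - 2 / real n)))))" for n
    proof -
      have "set_integrable lebesgue {0..l} (\<lambda>s. y s * of_real (\<phi>' n s))"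
        by (intro absolutely_integrable_continuous_real continuous_intros y c\<phi>')
      then have "set_integrable lebesgue {0<..<l} (\<lambda>s. y s * of_real (\<phi>' n s))"
        by (rule set_integrable_subset) auto
      then have "(LINT s:{0<..<l}|lebesgue. y s * of_real (\<phi>' n s)) =
        integral {0..l} (\<lambda>s. y s * of_real (\<phi>' n s))"
        by (simp add: set_lebesgue_integral_eq_integral integral_open_interval_real)
      also have "\<dots> = integral {0..l} (\<lambda>s. y s * of_real (real n * step' (real n * (s - 1 / real n)))
        - y s * of_real (real n * step' (real n * (s - (x - 2 / real n)))))"
        by (simp add: \<phi>'_def algebra_simps)
      finally show ?thesis using integral_diff[OF ci ci, of n "1 / real n" n "x - 2 / real n"] by simp
    qed
    show ?thesis unfolding eq
    proof (intro tendsto_diff step_approximates_evaluation y)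
      show "(\<lambda>n. 1 / real n) \<longlonglongrightarrow> 0" by (rule lim1)
      show "(\<lambda>n. x - 2 / real n) \<longlonglongrightarrow> x" using tendsto_diff[OF tendsto_const lim1, of x 2] by simp
      show "\<forall>\<^sub>F n in sequentially. 0 \<le> 1 / real n \<and> 1 / real n + 1 / real n \<le> l"
        using large
      proof eventually_elim
        case (elim n)
        have "3 / real n = 1 / real n + 1 / real n + 1 / real n" by (simp add: field_simps)
        moreover have "1 / real n \<ge> 0" by simp
        ultimately show ?case using elim x0 by linarith
      qed
      show "\<forall>\<^sub>F n in sequentially. 0 \<le> x - 2 / real n \<and> x - 2 / real n + 1 / real n \<le> l"
        using large
      proof eventually_elim
        case (elim n)
        have "3 / real n = 2 / real n + 1 / real n" "2 / real n = 1 / real n + 1 / real n"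
          by (simp_all add: field_simps)
        moreover have "1 / real n \<ge> 0" by simp
        ultimately show ?case using elim x0 by linarith
      qed
    qed (use x in auto)
  qed
  moreover have "\<forall>\<^sub>F n in sequentially. (LINT s:{0<..<l}|lebesgue. y s * of_real (\<phi>' n s)) =
      - (LINT s:{0<..<l}|lebesgue. g s * of_real (\<phi> n s))"
    using large by eventually_elim (use weak test in blast)
  ultimately have "(\<lambda>n. - (LINT s:{0<..<l}|lebesgue. g s * of_real (\<phi> n s))) \<longlonglongrightarrow> y 0 - y x"
    by (rule Lim_transform_eventually)
  then have L1: "(\<lambda>n. LINT s:{0<..<l}|lebesgue. g s * of_real (\<phi> n s)) \<longlonglongrightarrow> - (y 0 - y x)"
    using tendsto_minus_cancel_left by blast
  \<comment> \<open>The function side: on (0,l), \<open>\<phi> n\<close> tends pointwise to the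
    indicator of \<open>{0<..<x}\<close> and is bounded by 1, so |g| dominates.\<close>
  have L2: "(\<lambda>n. LINT s:{0<..<l}|lebesgue. g s * of_real (\<phi> n s)) \<longlonglongrightarrow> (LINT s:{0<..<x}|lebesgue. g s)"
    unfolding set_lebesgue_integral_def
  proof (rule integral_dominated_convergence[where w = "\<lambda>s. norm (indicator {0<..<l} s *\<^sub>R g s)"])
    have gi: "integrable lebesgue (\<lambda>s. indicator {0<..<l} s *\<^sub>R g s)"
      using g by (simp add: set_integrable_def)
    then show "integrable lebesgue (\<lambda>s. norm (indicator {0<..<l} s *\<^sub>R g s))" by (rule integrable_norm)
    have "integrable lebesgue (\<lambda>s. indicator {0<..<x} s *\<^sub>R g s)"
      using set_integrable_subset[OF g _ greaterThanLessThan_subseteq_greaterThanLessThan[THEN iffD2]] x0(2)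
      by (simp add: set_integrable_def)
    then show "(\<lambda>s. indicator {0<..<x} s *\<^sub>R g s) \<in> borel_measurable lebesgue"
      by (rule borel_measurable_integrable)
    fix n
    have "(\<lambda>s. complex_of_real (\<phi> n s)) \<in> borel_measurable lebesgue"
      by (intro measurable_completion) (simp add: borel_measurable_continuous_onI continuous_on_of_real c\<phi>)
    then have "(\<lambda>s. (indicator {0<..<l} s *\<^sub>R g s) * of_real (\<phi> n s)) \<in> borel_measurable lebesgue"
      using borel_measurable_integrable[OF gi] by (rule borel_measurable_times[rotated])
    then show "(\<lambda>s. indicator {0<..<l} s *\<^sub>R (g s * of_real (\<phi> n s))) \<in> borel_measurable lebesgue"
      by simp
    have "\<bar>\<phi> n s\<bar> \<le> 1" for s
      unfolding \<phi>_def using step_bounds[of "real n * (s - 1 / real n)"]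
        step_bounds[of "real n * (s - (x - 2 / real n))"] by linarith
    then have "norm (g s) * \<bar>\<phi> n s\<bar> \<le> norm (g s) * 1" for s
      by (intro mult_left_mono) auto
    then show "AE s in lebesgue. norm (indicator {0<..<l} s *\<^sub>R (g s * of_real (\<phi> n s))) \<le>
        norm (indicator {0<..<l} s *\<^sub>R g s)"
      by (auto simp: norm_mult indicator_def)
  next
    show "AE s in lebesgue. (\<lambda>n. indicator {0<..<l} s *\<^sub>R (g s * of_real (\<phi> n s)))
        \<longlonglongrightarrow> indicator {0<..<x} s *\<^sub>R g s"
    proof (rule AE_I2)
      fix s
      have e1: "\<forall>\<^sub>F n in sequentially. step (real n * (s - 1 / real n)) = 1" if "s > 0"
      proof -
        have "\<forall>\<^sub>F n in sequentially. 2 / real n < s" using order_tendstoD(2)[OF lim1 that] .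
        then show ?thesis using eventually_gt_at_top[of 0]
        proof eventually_elim
          case (elim n)
          then show ?case by (intro step_eq_1) (simp add: field_simps)
        qed
      qed
      have e2: "\<forall>\<^sub>F n in sequentially. step (real n * (s - (x - 2 / real n))) = (if s < x then 0 else 1)"
      proof (cases "s < x")
        case True
        then have "\<forall>\<^sub>F n in sequentially. 2 / real n < x - s" using order_tendstoD(2)[OF lim1] by simp
        then show ?thesis using eventually_gt_at_top[of 0]
        proof eventually_elim
          case (elim n)
          then have "real n * (s - (x - 2 / real n)) \<le> 0" by (intro mult_nonneg_nonpos) auto
          then show ?case using True by (simp add: step_eq_0)
        qed
      next
        case False
        show ?thesis using eventually_gt_at_top[of 0]
        proof eventually_elim
          case (elim n)
          \<comment> \<open>The shift by \<open>2 / real n\<close> completes the second step already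
            at \<open>s = x\<close>, so the limit there is 0, as for the open interval.\<close>
          have "real n * (s - (x - 2 / real n)) = real n * (s - x) + 2" using elim by (simp add: field_simps)
          moreover have "real n * (s - x) \<ge> 0" using False by simp
          ultimately have "real n * (s - (x - 2 / real n)) \<ge> 1" by linarith
          then show ?case using False by (simp add: step_eq_1)
        qed
      qed
      show "(\<lambda>n. indicator {0<..<l} s *\<^sub>R (g s * of_real (\<phi> n s))) \<longlonglongrightarrow> indicator {0<..<x} s *\<^sub>R g s"
      proof (cases "s \<in> {0<..<l}")
        case True
        then have "s > 0" by simp
        have "\<forall>\<^sub>F n in sequentially. indicator {0<..<x} s *\<^sub>R g s =
          indicator {0<..<l} s *\<^sub>R (g s * of_real (\<phi> n s))"
          using e1[OF \<open>s > 0\<close>] e2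
        proof eventually_elim
          case (elim n)
          then show ?case using True by (simp add: \<phi>_def)
        qed
        then show ?thesis by (rule Lim_transform_eventually[OF tendsto_const])
      next
        case False
        then show ?thesis using x0 by (auto simp: indicator_def)
      qed
    qed
  qed
  show ?thesis using LIMSEQ_unique[OF L1 L2] by simp
qed

section \<open>Integrability tools and the integrating factor\<close>

text \<open>Pointwise |h| <= 1 + |h|^2, by expanding (|h| - 1/2)^2 >= 0, and the constant 1 is
  integrable because \<open>S\<close> has finite measure.\<close>

lemma L2_on_imp_set_integrable:
  assumes "L2_on S h" and "S \<in> lmeasurable"
  shows "set_integrable lebesgue S h"
proof -
  have "integrable lebesgue (\<lambda>x. indicator S x *\<^sub>R (1 + (norm (h x))\<^sup>2))"
    using set_integral_add(1)[of lebesgue S "\<lambda>_. 1::real" "\<lambda>x. (norm (h x))\<^sup>2"] assms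
    by (auto simp: L2_on_def set_integrable_def fmeasurable_def)
  then show ?thesis unfolding set_integrable_def
  proof (rule Bochner_Integration.integrable_bound)
    show "(\<lambda>x. indicator S x *\<^sub>R h x) \<in> borel_measurable lebesgue"
      using assms by (simp add: L2_on_def set_borel_measurable_def)
    have "norm (h x) \<le> 1 + (norm (h x))\<^sup>2" for x
      using sum_squares_ge_zero[of "norm (h x) - 1/2" 0] by (simp add: power2_eq_square algebra_simps)
    then show "AE x in lebesgue. norm (indicator S x *\<^sub>R h x) \<le> norm (indicator S x *\<^sub>R (1 + (norm (h x))\<^sup>2))"
      by (auto simp: indicator_def)
  qed
qed

text \<open>Continuity on the compact interval makes \<open>h\<close> bounded on \<open>S\<close>;
  the enclosing interval allows \<open>S\<close> itself to be open.\<close>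

lemma set_integrable_mult_continuous:
  fixes g h :: "real \<Rightarrow> complex"
  assumes g: "set_integrable lebesgue S g" and S: "S \<in> sets lebesgue" "S \<subseteq> {a..b}"
    and h: "continuous_on {a..b} h"
  shows "set_integrable lebesgue S (\<lambda>x. g x * h x)"
proof -
  have "h \<in> borel_measurable (lebesgue_on S)"
    using continuous_imp_measurable_on_sets_lebesgue[OF continuous_on_subset[OF h S(2)] S(1)] .
  moreover have "bounded (h ` S)"
    using compact_imp_bounded[OF compact_continuous_image[OF h compact_Icc]] S(2)
    by (meson bounded_subset image_mono)
  ultimately have "(\<lambda>x. h x * g x) absolutely_integrable_on S"
    using absolutely_integrable_bounded_measurable_product[OF bilinear_times _ S(1) _ g] by blast
  then show ?thesis by (simp add: mult.commute)
qed

text \<open>The product of an exponential with a test function is again a test function with the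
  same support. Testing \<open>y\<close> against it shows that exp(cs) y has the weak derivative
  exp(cs) (g + c y), to which \<open>weak_derivative_FTC\<close> applies. This supplies the
  integrating factor for the first-order system.\<close>

lemma weak_derivative_FTC_exp:
  fixes y g :: "real \<Rightarrow> complex"
  assumes y: "continuous_on {0..l} y" and g: "set_integrable lebesgue {0<..<l} g"
    and weak: "\<And>\<phi> \<phi>'. test_function l \<phi> \<phi>' \<Longrightarrow>
      (LINT x:{0<..<l}|lebesgue. y x * \<phi>' x) = - (LINT x:{0<..<l}|lebesgue. g x * \<phi> x)"
    and x: "x \<in> {0..l}"
  shows "exp (c * of_real x) * y x - y 0 = (LINT s:{0<..<x}|lebesgue. exp (c * of_real s) * (g s + c * y s))"
proof -
  let ?E = "\<lambda>s. exp (c * complex_of_real s)"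
  have E: "continuous_on A ?E" for A by (intro continuous_intros)
  have iy: "set_integrable lebesgue {0<..<l} y"
    using absolutely_integrable_continuous_real[OF y] by (rule set_integrable_subset) auto
  have igy: "set_integrable lebesgue {0<..<l} (\<lambda>s. g s + c * y s)"
    by (intro set_integral_add(1) g) (use iy in simp)
  have "?E x * y x - ?E 0 * y 0 = (LINT s:{0<..<x}|lebesgue. ?E s * (g s + c * y s))"
  proof (rule weak_derivative_FTC[OF _ _ _ x])
    show "continuous_on {0..l} (\<lambda>s. ?E s * y s)" by (intro continuous_on_mult E y)
    show "set_integrable lebesgue {0<..<l} (\<lambda>s. ?E s * (g s + c * y s))"
      using set_integrable_mult_continuous[OF igy _ _ E[of "{0..l}"]] by (simp add: mult.commute subset_iff)
    fix \<phi> \<phi>' assume t: "test_function l \<phi> \<phi>'"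
    have c\<phi>: "continuous_on A \<phi>" for A
      using t unfolding test_function_def
      by (meson continuous_at_imp_continuous_on has_vector_derivative_continuous)
    have c\<phi>': "continuous_on A \<phi>'" for A
      using t unfolding test_function_def by (meson continuous_on_subset subset_UNIV)
    have dE: "(?E has_vector_derivative c * ?E s) (at s)" for s
      by (rule has_vector_derivative_real_field) (auto intro!: derivative_eq_intros)
    have "test_function l (\<lambda>s. ?E s * \<phi> s) (\<lambda>s. ?E s * \<phi>' s + c * ?E s * \<phi> s)"
      unfolding test_function_def
    proof (intro conjI allI)
      show "((\<lambda>s. ?E s * \<phi> s) has_vector_derivative ?E s * \<phi>' s + c * ?E s * \<phi> s) (at s)" for s
        using t by (intro has_vector_derivative_mult dE) (simp add: test_function_def)
      show "continuous_on UNIV (\<lambda>s. ?E s * \<phi>' s + c * ?E s * \<phi> s)"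
        by (intro continuous_intros c\<phi> c\<phi>')
      show "closure {s. ?E s * \<phi> s \<noteq> 0} \<subseteq> {0<..<l}"
        using t by (simp add: test_function_def)
    qed
    from weak[OF this]
    have w: "(LINT s:{0<..<l}|lebesgue. y s * (?E s * \<phi>' s + c * ?E s * \<phi> s)) =
      - (LINT s:{0<..<l}|lebesgue. g s * (?E s * \<phi> s))" .
    have i1: "set_integrable lebesgue {0<..<l} (\<lambda>s. y s * (?E s * \<phi>' s + c * ?E s * \<phi> s))"
      by (rule set_integrable_mult_continuous[OF iy, of 0 l]) (auto intro!: continuous_intros c\<phi> c\<phi>')
    have i2: "set_integrable lebesgue {0<..<l} (\<lambda>s. y s * (c * ?E s * \<phi> s))"
      by (rule set_integrable_mult_continuous[OF iy, of 0 l]) (auto intro!: continuous_intros c\<phi> c\<phi>')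
    have i3: "set_integrable lebesgue {0<..<l} (\<lambda>s. g s * (?E s * \<phi> s))"
      by (rule set_integrable_mult_continuous[OF g, of 0 l]) (auto intro!: continuous_intros c\<phi> c\<phi>')
    have "(LINT s:{0<..<l}|lebesgue. ?E s * y s * \<phi>' s) =
      (LINT s:{0<..<l}|lebesgue. y s * (?E s * \<phi>' s + c * ?E s * \<phi> s) - y s * (c * ?E s * \<phi> s))"
      by (simp add: algebra_simps)
    also have "\<dots> = - (LINT s:{0<..<l}|lebesgue. g s * (?E s * \<phi> s)) -
       (LINT s:{0<..<l}|lebesgue. y s * (c * ?E s * \<phi> s))"
      by (simp add: set_integral_diff(2)[OF i1 i2] w)
    also have "\<dots> = - (LINT s:{0<..<l}|lebesgue. g s * (?E s * \<phi> s) + y s * (c * ?E s * \<phi> s))"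
      by (simp add: set_integral_add(2)[OF i3 i2])
    also have "\<dots> = - (LINT s:{0<..<l}|lebesgue. ?E s * (g s + c * y s) * \<phi> s)"
      by (simp add: algebra_simps)
    finally show "(LINT s:{0<..<l}|lebesgue. ?E s * y s * \<phi>' s) =
      - (LINT s:{0<..<l}|lebesgue. ?E s * (g s + c * y s) * \<phi> s)" .
  qed
  then show ?thesis by simp
qed

section \<open>The first-order system behind \<open>e_f\<close>\<close>

text \<open>The coefficient \<sigma> of the system. Since \<open>wderiv\<close> picks some
  representative, only its class modulo null sets is meaningful.\<close>

definition log_deriv :: "real \<Rightarrow> (real \<Rightarrow> complex) \<Rightarrow> real \<Rightarrow> complex" where
  "log_deriv l f x = wderiv l f x / f x"

lemma W12_weak_derivative: "y \<in> W12 l \<Longrightarrow> weak_derivative l y (wderiv l y)"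
  by (auto simp: W12_def wderiv_def intro: someI[of "weak_derivative l y"])

text \<open>As \<open>f\<close> is continuous without zeros on the compact interval, 1/f is bounded,
  so multiplying the weak derivative by it stays in L2.\<close>

lemma L2_on_log_deriv:
  assumes "f \<in> W12 l" "\<forall>x\<in>{0..l}. f x \<noteq> 0"
  shows "L2_on {0<..<l} (log_deriv l f)"
proof -
  define h where "h x = inverse (f x)" for x
  have h: "continuous_on {0..l} h"
    using assms unfolding h_def W12_def by (auto intro!: continuous_intros)
  have lh: "log_deriv l f = (\<lambda>x. wderiv l f x * h x)"
    by (auto simp: log_deriv_def h_def field_simps)
  have L2: "L2_on {0<..<l} (wderiv l f)"
    using W12_weak_derivative[OF assms(1)] by (simp add: weak_derivative_def)
  then have "set_integrable lebesgue {0<..<l} (wderiv l f)"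
    by (rule L2_on_imp_set_integrable) auto
  then have "set_integrable lebesgue {0<..<l} (log_deriv l f)"
    unfolding lh by (rule set_integrable_mult_continuous[OF _ _ _ h]) auto
  then have m: "set_borel_measurable lebesgue {0<..<l} (log_deriv l f)"
    by (auto simp: set_borel_measurable_def set_integrable_def)
  \<comment> \<open>The real integrand is read as a complex one because
    \<open>set_integrable_mult_continuous\<close> is stated for complex functions.\<close>
  have "set_integrable lebesgue {0<..<l} (\<lambda>x. complex_of_real ((norm (wderiv l f x))\<^sup>2))"
    using L2 unfolding L2_on_def set_integrable_def
    by (auto dest!: integrable_of_real[where 'a=complex] simp: scaleR_conv_of_real)
  then have "set_integrable lebesgue {0<..<l} (\<lambda>x. complex_of_real ((norm (wderiv l f x))\<^sup>2) * complex_of_real ((norm (h x))\<^sup>2))"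
    by (rule set_integrable_mult_continuous[of _ _ 0 l]) (auto intro!: continuous_intros h)
  then have "set_integrable lebesgue {0<..<l} (\<lambda>x. Re (complex_of_real ((norm (wderiv l f x))\<^sup>2) * complex_of_real ((norm (h x))\<^sup>2)))"
    unfolding set_integrable_def by (drule_tac integrable_Re) simp
  then have "set_integrable lebesgue {0<..<l} (\<lambda>x. (norm (log_deriv l f x))\<^sup>2)"
    by (simp add: lh norm_mult power_mult_distrib)
  with m show ?thesis by (simp add: L2_on_def)
qed

text \<open>With z = D_f y the equation reads y' = z + \<sigma> y, z' = c^2 y - \<sigma> z. The
  combination \<open>w c\<close> diagonalizes the part without \<sigma>, giving (w c)' = c (w c) +
  \<sigma> w(-c), and exp(-cx) is its integrating factor. The choices c = i\<rho> and c = -i\<rho>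
  yield \<open>u\<close> and \<open>v\<close>; dividing by \<open>c\<close> excludes \<rho> =
  0.\<close>

lemma e_f_Duhamel:
  fixes l :: real and \<rho> c :: complex and f y :: "real \<Rightarrow> complex"
  defines "w \<equiv> \<lambda>c s. (y s + D_rep l f y s / c) / 2"
  assumes f: "f \<in> W12 l" "\<forall>x\<in>{0..l}. f x \<noteq> 0" and e: "is_e_f l f \<rho> y"
    and c: "c\<^sup>2 = - \<rho>\<^sup>2" "c \<noteq> 0" and x: "x \<in> {0..l}"
  shows "exp (- c * of_real x) * w c x =
      w c 0 + (LINT s:{0<..<x}|lebesgue. log_deriv l f s * (exp (- c * of_real s) * w (- c) s))"
    and "continuous_on {0..l} (w c)"
proof -
  define z where "z = D_rep l f y"
  from e have y: "y \<in> W12 l" and ex: "\<exists>z\<in>W12 l. ae_eq l z (D_f l f y)"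
    by (auto simp: is_e_f_def dom_S_def)
  from ex have "\<exists>z. z \<in> W12 l \<and> ae_eq l z (D_f l f y)" by blast
  then have "z \<in> W12 l \<and> ae_eq l z (D_f l f y)"
    unfolding z_def D_rep_def by (rule someI_ex)
  then have z: "z \<in> W12 l" and zae: "ae_eq l z (D_f l f y)" by auto
  have sae: "ae_eq l (S_f l f y) (\<lambda>x. \<rho>\<^sup>2 * y x)" using e by (simp add: is_e_f_def)
  have cy: "continuous_on {0..l} y" and cz: "continuous_on {0..l} z"
    using y z by (auto simp: W12_def)
  note wy = W12_weak_derivative[OF y] and wz = W12_weak_derivative[OF z]
  have iy: "set_integrable lebesgue {0<..<l} (wderiv l y)" and iz: "set_integrable lebesgue {0<..<l} (wderiv l z)"
    using wy wz by (auto simp: weak_derivative_def intro!: L2_on_imp_set_integrable)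
  have iz': "set_integrable lebesgue {0<..<l} (\<lambda>s. wderiv l z s / c)" using iz by simp
  have w: "w = (\<lambda>c s. (y s + z s / c) / 2)" by (simp add: w_def z_def)
  show cw: "continuous_on {0..l} (w c)"
    unfolding w using c by (intro continuous_intros cy cz) auto
  have cw': "continuous_on {0..l} (w (- c))"
    unfolding w using c by (intro continuous_intros cy cz) auto
  define g where "g s = (wderiv l y s + wderiv l z s / c) / 2" for s
  have ig: "set_integrable lebesgue {0<..<l} g"
    unfolding g_def using set_integral_add(1)[OF iy iz'] by simp
  have "exp (- c * of_real x) * w c x - w c 0 =
      (LINT s:{0<..<x}|lebesgue. exp (- c * of_real s) * (g s + (- c) * w c s))"
  proof (rule weak_derivative_FTC_exp[OF cw ig _ x])
    fix \<phi> \<phi>' assume t: "test_function l \<phi> \<phi>'"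
    have c\<phi>: "continuous_on A \<phi>" for A
      using t unfolding test_function_def
      by (meson continuous_at_imp_continuous_on has_vector_derivative_continuous)
    have c\<phi>': "continuous_on A \<phi>'" for A
      using t unfolding test_function_def by (meson continuous_on_subset subset_UNIV)
    have i: "set_integrable lebesgue {0<..<l} (\<lambda>s. h s * \<phi>' s)" if "continuous_on {0..l} h" for h
      by (rule set_integrable_subset[OF absolutely_integrable_continuous_real])
         (auto intro!: continuous_intros that c\<phi>')
    have ig: "set_integrable lebesgue {0<..<l} (\<lambda>s. h s * \<phi> s)" if "set_integrable lebesgue {0<..<l} h" for h
      by (rule set_integrable_mult_continuous[OF that _ _ c\<phi>, of 0 l]) auto
    have "(LINT s:{0<..<l}|lebesgue. w c s * \<phi>' s) =
      (LINT s:{0<..<l}|lebesgue. (y s * \<phi>' s) / 2 + (z s * \<phi>' s) / (2 * c))"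
    proof -
      have "w c s * \<phi>' s = (y s * \<phi>' s) / 2 + (z s * \<phi>' s) / (2 * c)" for s
        using c by (simp add: w field_simps)
      then show ?thesis by simp
    qed
    also have "\<dots> = (LINT s:{0<..<l}|lebesgue. y s * \<phi>' s) / 2 + (LINT s:{0<..<l}|lebesgue. z s * \<phi>' s) / (2 * c)"
      using set_integral_add(2)[of lebesgue "{0<..<l}" "\<lambda>s. (y s * \<phi>' s) / 2" "\<lambda>s. (z s * \<phi>' s) / (2 * c)"] i[OF cy] i[OF cz]
      by simp
    also have "\<dots> = - ((LINT s:{0<..<l}|lebesgue. wderiv l y s * \<phi> s) / 2 + (LINT s:{0<..<l}|lebesgue. wderiv l z s * \<phi> s) / (2 * c))"
      using wy wz t by (auto simp: weak_derivative_def)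
    also have "(LINT s:{0<..<l}|lebesgue. wderiv l y s * \<phi> s) / 2 + (LINT s:{0<..<l}|lebesgue. wderiv l z s * \<phi> s) / (2 * c) =
      (LINT s:{0<..<l}|lebesgue. (wderiv l y s * \<phi> s) / 2 + (wderiv l z s * \<phi> s) / (2 * c))"
      using set_integral_add(2)[of lebesgue "{0<..<l}" "\<lambda>s. (wderiv l y s * \<phi> s) / 2" "\<lambda>s. (wderiv l z s * \<phi> s) / (2 * c)"] ig[OF iy] ig[OF iz]
      by simp
    also have "\<dots> = (LINT s:{0<..<l}|lebesgue. g s * \<phi> s)"
    proof -
      have "(wderiv l y s * \<phi> s) / 2 + (wderiv l z s * \<phi> s) / (2 * c) = g s * \<phi> s" for s
        using c by (simp add: g_def field_simps)
      then show ?thesis by simp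
    qed
    finally show "(LINT s:{0<..<l}|lebesgue. w c s * \<phi>' s) = - (LINT s:{0<..<l}|lebesgue. g s * \<phi> s)" .
  qed
  also have "\<dots> = (LINT s:{0<..<x}|lebesgue. log_deriv l f s * (exp (- c * of_real s) * w (- c) s))"
    unfolding set_lebesgue_integral_def
  proof (rule integral_cong_AE)
    have E: "continuous_on {0..l} (\<lambda>s. exp (- c * complex_of_real s))" by (intro continuous_intros)
    have sub: "{0<..<x} \<subseteq> {0<..<l}" using x by auto
    have "set_integrable lebesgue {0<..<l} (\<lambda>s. g s + (- c) * w c s)"
      using set_integrable_subset[OF absolutely_integrable_continuous_real[OF cw], of "{0<..<l}"]
      by (intro set_integral_add(1) ig set_integrable_mult_right) (auto simp: subset_iff)
    from set_integrable_mult_continuous[OF this _ _ E]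
    have "set_integrable lebesgue {0<..<l} (\<lambda>s. exp (- c * of_real s) * (g s + (- c) * w c s))"
      by (simp add: mult.commute subset_iff)
    from set_integrable_subset[OF this _ sub]
    show "(\<lambda>s. indicator {0<..<x} s *\<^sub>R (exp (- c * of_real s) * (g s + - c * w c s))) \<in> borel_measurable lebesgue"
      by (simp add: set_integrable_def)
    have "set_integrable lebesgue {0<..<l} (log_deriv l f)"
      using L2_on_log_deriv[OF f] by (rule L2_on_imp_set_integrable) auto
    from set_integrable_mult_continuous[OF this _ _ continuous_on_mult[OF E cw']]
    have "set_integrable lebesgue {0<..<l} (\<lambda>s. log_deriv l f s * (exp (- c * of_real s) * w (- c) s))"
      by (simp add: subset_iff)
    from set_integrable_subset[OF this _ sub]
    show "(\<lambda>s. indicator {0<..<x} s *\<^sub>R (log_deriv l f s * (exp (- c * of_real s) * w (- c) s))) \<in> borel_measurable lebesgue"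
      by (simp add: set_integrable_def)
    \<comment> \<open>The representation of \<open>z\<close> and the eigenvalue equation hold only
      almost everywhere, which suffices under the integral.\<close>
    show "AE s in lebesgue. indicator {0<..<x} s *\<^sub>R (exp (- c * of_real s) * (g s + - c * w c s)) =
       indicator {0<..<x} s *\<^sub>R (log_deriv l f s * (exp (- c * of_real s) * w (- c) s))"
      using zae sae unfolding ae_eq_def
    proof eventually_elim
      case (elim s)
      show ?case
      proof (cases "s \<in> {0<..<x}")
        case True
        with x have s: "s \<in> {0<..<l}" by auto
        have y': "wderiv l y s = z s + log_deriv l f s * y s"
          using elim s by (simp add: D_f_def log_deriv_def)
        have "- (wderiv l z s + log_deriv l f s * z s) = \<rho>\<^sup>2 * y s"
          using elim s by (simp add: S_f_def D_inv_def log_deriv_def z_def)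
        then have z': "wderiv l z s = c\<^sup>2 * y s - log_deriv l f s * z s"
          using c by (simp add: algebra_simps) (metis add.commute add_minus_cancel neg_eq_iff_add_eq_0)
        have "g s - c * w c s = log_deriv l f s * w (- c) s"
          unfolding g_def y' z' w using c(2) by (simp add: field_simps power2_eq_square)
        then show ?thesis by simp
      qed simp
    qed
  qed
  finally show "exp (- c * of_real x) * w c x =
      w c 0 + (LINT s:{0<..<x}|lebesgue. log_deriv l f s * (exp (- c * of_real s) * w (- c) s))"
    by (simp add: algebra_simps)
qed

section \<open>The wave system: contraction estimate and solutions from exponentials\<close>

text \<open>By AM-GM, \<open>|\<sigma>| exp(-\<mu>(x-s)) \<le> (|\<sigma>|\<^sup>2/\<mu> + \<mu> exp(-2\<mu>(x-s)))/2\<close>; with \<open>\<mu> = 1 + \<integral>|\<sigma>|\<^sup>2\<close> the two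
  terms contribute at most \<open>1/2\<close> and \<open>1/4\<close>.\<close>

lemma weighted_integral_contraction:
  fixes \<sigma> :: "real \<Rightarrow> complex"
  assumes \<sigma>: "L2_on {0<..<l} \<sigma>"
  obtains \<mu> where "\<mu> \<ge> 0" "\<And>x. x \<in> {0..l} \<Longrightarrow>
    set_integrable lebesgue {0<..<x} (\<lambda>s. norm (\<sigma> s) * exp (\<mu> * s)) \<and>
    (LINT s:{0<..<x}|lebesgue. norm (\<sigma> s) * exp (\<mu> * s)) \<le> 3/4 * exp (\<mu> * x)"
proof
  define A where "A = (LINT s:{0<..<l}|lebesgue. (norm (\<sigma> s))\<^sup>2)"
  have A0: "A \<ge> 0" unfolding A_def set_lebesgue_integral_def by (rule integral_nonneg_AE) auto
  define \<mu> where "\<mu> = A + 1"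
  have l1: "\<mu> > 0" using A0 by (simp add: \<mu>_def)
  then show "\<mu> \<ge> 0" by simp
  have i2: "set_integrable lebesgue {0<..<l} (\<lambda>s. (norm (\<sigma> s))\<^sup>2)"
    using \<sigma> by (simp add: L2_on_def)
  have i1: "set_integrable lebesgue {0<..<l} \<sigma>"
    using \<sigma> by (rule L2_on_imp_set_integrable) auto
  fix x assume x: "x \<in> {0..l}"
  then have sub: "{0<..<x} \<subseteq> {0<..<l}" by auto
  have "set_integrable lebesgue {0<..<l} (\<lambda>s. \<sigma> s * of_real (exp (\<mu> * s)))"
    by (rule set_integrable_mult_continuous[OF i1, of 0 l]) (auto intro!: continuous_intros)
  then have "set_integrable lebesgue {0<..<l} (\<lambda>s. norm (\<sigma> s * of_real (exp (\<mu> * s))))"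
    by (rule set_integrable_norm)
  then have "set_integrable lebesgue {0<..<l} (\<lambda>s. norm (\<sigma> s) * exp (\<mu> * s))"
    by (simp add: norm_mult)
  then have i: "set_integrable lebesgue {0<..<x} (\<lambda>s. norm (\<sigma> s) * exp (\<mu> * s))"
    by (rule set_integrable_subset[OF _ _ sub]) simp
  have i2x: "set_integrable lebesgue {0<..<x} (\<lambda>s. (norm (\<sigma> s))\<^sup>2)"
    by (rule set_integrable_subset[OF i2 _ sub]) simp
  \<comment> \<open>Its primitive \<open>exp (2 * \<mu> * (s - x)) / 2\<close> takes values in
    [0, 1/2] on \<open>{0..x}\<close>, so the integral is at most 1/2 for every
    \<open>x\<close>.\<close>
  define h where "h s = \<mu> * exp (2 * \<mu> * (s - x))" for s
  have h_int: "(h has_integral (exp (2 * \<mu> * (x - x)) / 2 - exp (2 * \<mu> * (0 - x)) / 2)) {0..x}"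
    unfolding h_def using x
    by (intro fundamental_theorem_of_calculus)
       (auto simp: has_real_derivative_iff_has_vector_derivative[symmetric] intro!: derivative_eq_intros)
  have "set_integrable lebesgue {0..x} h"
    unfolding h_def by (intro absolutely_integrable_continuous_real continuous_intros)
  then have ih: "set_integrable lebesgue {0<..<x} h" by (rule set_integrable_subset) auto
  have "(LINT s:{0<..<x}|lebesgue. h s) = integral {0..x} h"
    by (simp add: set_lebesgue_integral_eq_integral[OF ih] integral_open_interval_real)
  also have "\<dots> \<le> 1/2" using integral_unique[OF h_int] by simp
  finally have h2: "(LINT s:{0<..<x}|lebesgue. h s) \<le> 1/2" .
  have "(LINT s:{0<..<x}|lebesgue. (norm (\<sigma> s))\<^sup>2) \<le> A"
    unfolding A_def set_lebesgue_integral_def using i2 i2x sub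
    by (intro integral_mono) (auto simp: set_integrable_def indicator_def)
  then have A: "(LINT s:{0<..<x}|lebesgue. (norm (\<sigma> s))\<^sup>2) / \<mu> \<le> 1"
    using l1 by (simp add: \<mu>_def pos_divide_le_eq)
  have "(LINT s:{0<..<x}|lebesgue. norm (\<sigma> s) * exp (\<mu> * s)) \<le>
    (LINT s:{0<..<x}|lebesgue. exp (\<mu> * x) / 2 * ((norm (\<sigma> s))\<^sup>2 / \<mu> + h s))"
  proof (rule set_integral_mono[OF i])
    show "set_integrable lebesgue {0<..<x} (\<lambda>s. exp (\<mu> * x) / 2 * ((norm (\<sigma> s))\<^sup>2 / \<mu> + h s))"
      by (intro set_integrable_mult_right set_integral_add(1) ih set_integrable_divide i2x)
    fix s
    define b where "b = exp (\<mu> * (s - x))"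
    have e: "exp (\<mu> * s) = exp (\<mu> * x) * b" "h s = \<mu> * b\<^sup>2"
      by (simp_all add: b_def h_def exp_add[symmetric] exp_double[symmetric] algebra_simps)
    have "0 \<le> (norm (\<sigma> s) - \<mu> * b)\<^sup>2 / \<mu>" using l1 by simp
    also have "\<dots> = (norm (\<sigma> s))\<^sup>2 / \<mu> + \<mu> * b\<^sup>2 - 2 * (norm (\<sigma> s) * b)"
      using l1 by (simp add: field_simps power2_eq_square)
    finally have "norm (\<sigma> s) * b \<le> ((norm (\<sigma> s))\<^sup>2 / \<mu> + h s) / 2" unfolding e by simp
    then have "exp (\<mu> * x) * (norm (\<sigma> s) * b) \<le> exp (\<mu> * x) * (((norm (\<sigma> s))\<^sup>2 / \<mu> + h s) / 2)"
      by (rule mult_left_mono) simp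
    then show "norm (\<sigma> s) * exp (\<mu> * s) \<le> exp (\<mu> * x) / 2 * ((norm (\<sigma> s))\<^sup>2 / \<mu> + h s)"
      unfolding e(1) by (simp add: mult_ac)
  qed
  also have "\<dots> = exp (\<mu> * x) / 2 * ((LINT s:{0<..<x}|lebesgue. (norm (\<sigma> s))\<^sup>2) / \<mu> + (LINT s:{0<..<x}|lebesgue. h s))"
    using set_integral_add(2)[OF set_integrable_divide[OF i2x] ih, of \<mu>] by simp
  also have "\<dots> \<le> exp (\<mu> * x) / 2 * (3/2)"
    by (rule mult_left_mono) (use A h2 in linarith, simp)
  finally show "set_integrable lebesgue {0<..<x} (\<lambda>s. norm (\<sigma> s) * exp (\<mu> * s)) \<and>
    (LINT s:{0<..<x}|lebesgue. norm (\<sigma> s) * exp (\<mu> * s)) \<le> 3/4 * exp (\<mu> * x)"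
    using i by simp
qed

text \<open>On the triangle \<open>x + |t| \<le> l\<close>, which the characteristics through \<open>(x,t)\<close> do not leave when \<open>x\<close>
  decreases. Boundedness is part of the definition so that the weighted supremum in the
  contraction argument is finite.\<close>

definition wave_solution :: "real \<Rightarrow> (real \<Rightarrow> complex) \<Rightarrow> (real \<Rightarrow> complex) \<Rightarrow>
    (real \<Rightarrow> real \<Rightarrow> complex) \<Rightarrow> (real \<Rightarrow> real \<Rightarrow> complex) \<Rightarrow> bool" where
  "wave_solution l \<sigma> p U V \<longleftrightarrow>
    (\<forall>x t. 0 \<le> x \<longrightarrow> x + \<bar>t\<bar> \<le> l \<longrightarrow>
      set_integrable lebesgue {0<..<x} (\<lambda>s. \<sigma> s * V s (t + x - s)) \<and>
      set_integrable lebesgue {0<..<x} (\<lambda>s. \<sigma> s * U s (t - x + s)) \<and>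
      U x t = p (x + t) + (LINT s:{0<..<x}|lebesgue. \<sigma> s * V s (t + x - s)) \<and>
      V x t = (LINT s:{0<..<x}|lebesgue. \<sigma> s * U s (t - x + s))) \<and>
    (\<exists>B. \<forall>x t. 0 \<le> x \<longrightarrow> x + \<bar>t\<bar> \<le> l \<longrightarrow> norm (U x t) \<le> B \<and> norm (V x t) \<le> B)"

text \<open>Linearity of the system. It extends the solutions for single exponentials to their
  sums.\<close>

lemma wave_solution_add:
  assumes "wave_solution l \<sigma> p U V" "wave_solution l \<sigma> p' U' V'"
  shows "wave_solution l \<sigma> (\<lambda>t. p t + p' t) (\<lambda>x t. U x t + U' x t) (\<lambda>x t. V x t + V' x t)"
proof -
  obtain B where B: "\<And>x t. 0 \<le> x \<Longrightarrow> x + \<bar>t\<bar> \<le> l \<Longrightarrow> norm (U x t) \<le> B \<and> norm (V x t) \<le> B"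
    using assms(1) unfolding wave_solution_def by blast
  obtain B' where B': "\<And>x t. 0 \<le> x \<Longrightarrow> x + \<bar>t\<bar> \<le> l \<Longrightarrow> norm (U' x t) \<le> B' \<and> norm (V' x t) \<le> B'"
    using assms(2) unfolding wave_solution_def by blast
  have bd: "\<exists>B. \<forall>x t. 0 \<le> x \<longrightarrow> x + \<bar>t\<bar> \<le> l \<longrightarrow>
      norm (U x t + U' x t) \<le> B \<and> norm (V x t + V' x t) \<le> B"
  proof (intro exI[of _ "B + B'"] allI impI)
    fix x t :: real assume "0 \<le> x" "x + \<bar>t\<bar> \<le> l"
    from B[OF this] B'[OF this] show "norm (U x t + U' x t) \<le> B + B' \<and> norm (V x t + V' x t) \<le> B + B'"
      by (auto intro: norm_triangle_mono)
  qed
  have eqs: "set_integrable lebesgue {0<..<x} (\<lambda>s. \<sigma> s * (V s (t + x - s) + V' s (t + x - s))) \<and>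
      set_integrable lebesgue {0<..<x} (\<lambda>s. \<sigma> s * (U s (t - x + s) + U' s (t - x + s))) \<and>
      U x t + U' x t = p (x + t) + p' (x + t) +
        (LINT s:{0<..<x}|lebesgue. \<sigma> s * (V s (t + x - s) + V' s (t + x - s))) \<and>
      V x t + V' x t = (LINT s:{0<..<x}|lebesgue. \<sigma> s * (U s (t - x + s) + U' s (t - x + s)))"
    if "0 \<le> x" "x + \<bar>t\<bar> \<le> l" for x t
  proof -
    have 1: "set_integrable lebesgue {0<..<x} (\<lambda>s. \<sigma> s * V s (t + x - s))"
      "set_integrable lebesgue {0<..<x} (\<lambda>s. \<sigma> s * U s (t - x + s))"
      "U x t = p (x + t) + (LINT s:{0<..<x}|lebesgue. \<sigma> s * V s (t + x - s))"
      "V x t = (LINT s:{0<..<x}|lebesgue. \<sigma> s * U s (t - x + s))"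
      using assms(1) that unfolding wave_solution_def by blast+
    have 2: "set_integrable lebesgue {0<..<x} (\<lambda>s. \<sigma> s * V' s (t + x - s))"
      "set_integrable lebesgue {0<..<x} (\<lambda>s. \<sigma> s * U' s (t - x + s))"
      "U' x t = p' (x + t) + (LINT s:{0<..<x}|lebesgue. \<sigma> s * V' s (t + x - s))"
      "V' x t = (LINT s:{0<..<x}|lebesgue. \<sigma> s * U' s (t - x + s))"
      using assms(2) that unfolding wave_solution_def by blast+
    show ?thesis
      using set_integral_add[OF 1(1) 2(1)] set_integral_add[OF 1(2) 2(2)]
      by (simp add: distrib_left 1(3,4) 2(3,4))
  qed
  show ?thesis unfolding wave_solution_def using bd eqs by blast
qed

text \<open>An a priori estimate whose constant is independent of \<open>p\<close>. In the norm
  weighted by exp(-\<mu> x) the integral terms have factor 3/4, so the weighted supremum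
  \<open>m\<close> of |U| and |V| satisfies m <= P + 3/4 m, that is m <= 4 P. Removing the weight
  costs exp(\<mu> l), and adding \<open>U\<close> and \<open>V\<close> costs a factor 2.\<close>

lemma wave_solution_bound:
  assumes \<sigma>: "L2_on {0<..<l} \<sigma>" and l: "l \<ge> 0"
  obtains C where "\<And>p U V P x. wave_solution l \<sigma> p U V \<Longrightarrow> (\<And>t. t \<in> {-l..l} \<Longrightarrow> norm (p t) \<le> P) \<Longrightarrow>
    x \<in> {0..l} \<Longrightarrow> norm (U x 0 + V x 0) \<le> C * P"
proof -
  obtain \<mu> where \<mu>: "\<mu> \<ge> 0" and con: "\<And>x. x \<in> {0..l} \<Longrightarrow>
    set_integrable lebesgue {0<..<x} (\<lambda>s. norm (\<sigma> s) * exp (\<mu> * s)) \<and>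
    (LINT s:{0<..<x}|lebesgue. norm (\<sigma> s) * exp (\<mu> * s)) \<le> 3/4 * exp (\<mu> * x)"
    by (rule weighted_integral_contraction[OF \<sigma>]) blast
  have *: "norm (U x 0 + V x 0) \<le> 8 * exp (\<mu> * l) * P"
    if ws: "wave_solution l \<sigma> p U V" and P: "\<And>t. t \<in> {-l..l} \<Longrightarrow> norm (p t) \<le> P"
      and x: "x \<in> {0..l}" for p U V P x
  proof -
    define W where "W = (\<lambda>(x, t). exp (- (\<mu> * x)) * max (norm (U x t)) (norm (V x t)))"
    define R where "R = {(x, t). 0 \<le> x \<and> x + \<bar>t\<bar> \<le> l}"
    define m where "m = Sup (W ` R)"
    have P0: "P \<ge> 0" using order_trans[OF norm_ge_zero P[of 0]] l by simp
    obtain B where B: "\<And>x t. 0 \<le> x \<Longrightarrow> x + \<bar>t\<bar> \<le> l \<Longrightarrow> norm (U x t) \<le> B \<and> norm (V x t) \<le> B"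
      using ws unfolding wave_solution_def by blast
    have bdd: "bdd_above (W ` R)"
    proof (rule bdd_aboveI2)
      fix r assume "r \<in> R"
      then obtain x t where r: "r = (x, t)" "0 \<le> x" "x + \<bar>t\<bar> \<le> l" by (auto simp: R_def)
      have "exp (- (\<mu> * x)) \<le> 1" using r \<mu> by simp
      then have "exp (- (\<mu> * x)) * max (norm (U x t)) (norm (V x t)) \<le> 1 * max (norm (U x t)) (norm (V x t))"
        by (rule mult_right_mono) (simp add: le_max_iff_disj)
      then show "W r \<le> B" using B[of x t] r by (auto simp: W_def)
    qed
    have ne: "(0, 0) \<in> R" using l by (simp add: R_def)
    have m0: "m \<ge> 0"
      unfolding m_def by (rule cSUP_upper2[OF bdd ne]) (simp add: W_def le_max_iff_disj)
    have le_m: "norm (U s t) \<le> m * exp (\<mu> * s)" "norm (V s t) \<le> m * exp (\<mu> * s)" if "(s, t) \<in> R" for s t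
    proof -
      have "W (s, t) \<le> m" unfolding m_def using bdd that by (rule cSUP_upper[rotated])
      then have "max (norm (U s t)) (norm (V s t)) \<le> m * exp (\<mu> * s)"
        by (simp add: W_def exp_minus field_simps)
      then show "norm (U s t) \<le> m * exp (\<mu> * s)" "norm (V s t) \<le> m * exp (\<mu> * s)" by auto
    qed
    have int_le: "norm (LINT s:{0<..<x}|lebesgue. \<sigma> s * F s) \<le> m * (3/4 * exp (\<mu> * x))"
      if "x \<in> {0..l}" and F: "\<And>s. s \<in> {0<..<x} \<Longrightarrow> norm (F s) \<le> m * exp (\<mu> * s)"
        and i: "set_integrable lebesgue {0<..<x} (\<lambda>s. \<sigma> s * F s)" for F x
    proof -
      have "norm (LINT s:{0<..<x}|lebesgue. \<sigma> s * F s) \<le> (LINT s:{0<..<x}|lebesgue. norm (\<sigma> s * F s))"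
        using i by (rule set_integral_norm_bound)
      also have "\<dots> \<le> (LINT s:{0<..<x}|lebesgue. m * (norm (\<sigma> s) * exp (\<mu> * s)))"
      proof (rule set_integral_mono)
        show "set_integrable lebesgue {0<..<x} (\<lambda>s. norm (\<sigma> s * F s))"
          using i by (rule set_integrable_norm)
        show "set_integrable lebesgue {0<..<x} (\<lambda>s. m * (norm (\<sigma> s) * exp (\<mu> * s)))"
          using con[OF that(1)] by (intro set_integrable_mult_right) auto
        fix s assume "s \<in> {0<..<x}"
        from mult_left_mono[OF F[OF this] norm_ge_zero[of "\<sigma> s"]]
        show "norm (\<sigma> s * F s) \<le> m * (norm (\<sigma> s) * exp (\<mu> * s))"
          by (simp add: norm_mult mult_ac)
      qed
      also have "\<dots> = m * (LINT s:{0<..<x}|lebesgue. norm (\<sigma> s) * exp (\<mu> * s))" by simp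
      also have "\<dots> \<le> m * (3/4 * exp (\<mu> * x))"
        using con[OF that(1)] m0 by (intro mult_left_mono) auto
      finally show ?thesis .
    qed
    have "m \<le> P + 3/4 * m" unfolding m_def
    proof (rule cSUP_least)
      show "R \<noteq> {}" using ne by auto
      fix r assume "r \<in> R"
      then obtain x t where r: "r = (x, t)" "0 \<le> x" "x + \<bar>t\<bar> \<le> l" by (auto simp: R_def)
      have x: "x \<in> {0..l}" using r by auto
      have E: "1 \<le> exp (\<mu> * x)" using \<mu> r by simp
      have eqs: "set_integrable lebesgue {0<..<x} (\<lambda>s. \<sigma> s * V s (t + x - s))"
        "set_integrable lebesgue {0<..<x} (\<lambda>s. \<sigma> s * U s (t - x + s))"
        "U x t = p (x + t) + (LINT s:{0<..<x}|lebesgue. \<sigma> s * V s (t + x - s))"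
        "V x t = (LINT s:{0<..<x}|lebesgue. \<sigma> s * U s (t - x + s))"
        using ws r unfolding wave_solution_def by blast+
      \<comment> \<open>Once the weight exp(-\<mu> x) is applied, the term from \<open>p\<close>
        contributes at most \<open>P\<close>.\<close>
      have PE: "P \<le> P * exp (\<mu> * x)" using mult_left_mono[OF E P0] by simp
      have "norm (V x t) \<le> m * (3/4 * exp (\<mu> * x))"
        unfolding eqs(4) by (rule int_le[OF x le_m(1) eqs(2)]) (use r in \<open>auto simp: R_def\<close>)
      moreover have "norm (U x t) \<le> P + m * (3/4 * exp (\<mu> * x))"
        unfolding eqs(3) using r
        by (intro norm_triangle_mono P int_le[OF x le_m(2) eqs(1)]) (auto simp: R_def)
      ultimately have "max (norm (U x t)) (norm (V x t)) \<le> P * exp (\<mu> * x) + m * (3/4 * exp (\<mu> * x))"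
        using P0 PE by auto
      then have "W r \<le> P + 3/4 * m"
        unfolding r(1) W_def by (simp add: exp_minus field_simps)
      then show "W r \<le> P + 3/4 * Sup (W ` R)" by (simp only: m_def)
    qed
    then have m4: "m \<le> 4 * P" by simp
    have xR: "(x, 0) \<in> R" using x by (auto simp: R_def)
    have "norm (U x 0 + V x 0) \<le> m * exp (\<mu> * x) + m * exp (\<mu> * x)"
      using le_m[OF xR] by (rule norm_triangle_mono)
    also have "\<dots> = 2 * m * exp (\<mu> * x)" by simp
    also have "\<dots> \<le> 2 * (4 * P) * exp (\<mu> * l)"
      using m4 m0 P0 \<mu> x by (intro mult_mono) (auto intro: mult_left_mono)
    finally show ?thesis by (simp add: mult_ac)
  qed
  show ?thesis by (rule that[of "8 * exp (\<mu> * l)"]) (rule *)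
qed

text \<open>Separation of variables: the two Duhamel formulas multiplied by plane waves in
  \<open>t\<close> become the two equations of the system. The factor \<open>k\<close> lets sums of
  such solutions cover all linear combinations.\<close>

lemma e_f_wave_solution:
  fixes \<rho> :: real and k :: complex and f y :: "real \<Rightarrow> complex"
  assumes f: "f \<in> W12 l" "\<forall>x\<in>{0..l}. f x \<noteq> 0" and e: "is_e_f l f (of_real \<rho>) y" and \<rho>: "\<rho> \<noteq> 0"
  obtains U V where "wave_solution l (log_deriv l f) (\<lambda>t. k * exp (\<i> * of_real \<rho> * of_real t)) U V"
    and "\<And>x. U x 0 + V x 0 = k * y x"
proof -
  define a where "a = \<i> * complex_of_real \<rho>"
  have a: "a\<^sup>2 = - (complex_of_real \<rho>)\<^sup>2" "a \<noteq> 0" "(- a)\<^sup>2 = - (complex_of_real \<rho>)\<^sup>2" "- a \<noteq> 0"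
    using \<rho> by (auto simp: a_def power_mult_distrib)
  define w where "w c s = (y s + D_rep l f y s / c) / 2" for c s
  define \<sigma> where "\<sigma> = log_deriv l f"
  have y0: "y 0 = 1" "D_rep l f y 0 = a" using e by (auto simp: is_e_f_def a_def)
  \<comment> \<open>The initial data of \<open>e_f\<close> put the whole initial value into
    \<open>w a\<close>, so \<open>p\<close> enters the equation for \<open>U\<close> only.\<close>
  then have w0: "w a 0 = 1" "w (- a) 0 = 0" using a(2) by (simp_all add: w_def)
  have D1: "exp (- a * of_real x) * w a x = 1 + (LINT s:{0<..<x}|lebesgue. \<sigma> s * (exp (- a * of_real s) * w (- a) s))"
    and D2: "exp (a * of_real x) * w (- a) x = (LINT s:{0<..<x}|lebesgue. \<sigma> s * (exp (a * of_real s) * w a s))"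
    if "x \<in> {0..l}" for x
    using e_f_Duhamel(1)[OF f e a(1,2) that] e_f_Duhamel(1)[OF f e a(3,4) that] w0
    by (simp_all add: w_def \<sigma>_def)
  have cw: "continuous_on {0..l} (w a)" "continuous_on {0..l} (w (- a))"
  proof -
    have "continuous_on {0..l} (w a) \<and> continuous_on {0..l} (w (- a))"
    \<comment> \<open>For negative \<open>l\<close> the interval is empty; otherwise 0 serves as the
      point that \<open>e_f_Duhamel\<close> asks for.\<close>
    proof (cases "l \<ge> 0")
      case True
      then have 0: "0 \<in> {0..l}" by simp
      from e_f_Duhamel(2)[OF f e a(1,2) 0] e_f_Duhamel(2)[OF f e a(3,4) 0]
      show ?thesis unfolding w_def by blast
    qed simp
    then show "continuous_on {0..l} (w a)" "continuous_on {0..l} (w (- a))" by auto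
  qed
  define E where "E t = k * exp (a * complex_of_real t)" for t
  have normE: "norm (E t) = norm k" for t by (simp add: E_def a_def norm_mult)
  have Ead: "E (u + v) = E u * exp (a * of_real v)" "E (u - v) = E u * exp (- a * of_real v)" for u v
    by (simp_all add: E_def exp_add[symmetric] algebra_simps)
  have cE: "continuous_on A E" for A unfolding E_def by (intro continuous_intros)
  have i\<sigma>: "set_integrable lebesgue {0<..<l} \<sigma>"
    unfolding \<sigma>_def using L2_on_log_deriv[OF f] by (rule L2_on_imp_set_integrable) auto
  have int: "set_integrable lebesgue {0<..<x} (\<lambda>s. \<sigma> s * h s)" if "continuous_on {0..l} h" "x \<le> l" for h x
    using set_integrable_mult_continuous[OF i\<sigma> _ _ that(1)] 
    by (rule set_integrable_subset) (use that(2) in auto)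
  have "wave_solution l \<sigma> E (\<lambda>x t. w a x * E t) (\<lambda>x t. w (- a) x * E t)"
    unfolding wave_solution_def
  proof (intro conjI allI impI)
    fix x t assume xt: "0 \<le> x" "x + \<bar>t\<bar> \<le> l"
    then have x: "x \<in> {0..l}" by auto
    show "set_integrable lebesgue {0<..<x} (\<lambda>s. \<sigma> s * (w (- a) s * E (t + x - s)))"
      "set_integrable lebesgue {0<..<x} (\<lambda>s. \<sigma> s * (w a s * E (t - x + s)))"
      using x by (auto intro!: int continuous_intros cw continuous_on_compose2[OF cE[of UNIV]])
    \<comment> \<open>Multiplying by E(x + t) turns the factor exp(-as) under the integral into the
      shift to E(t + x - s) along the characteristic.\<close>
    have "w a x * E t = E (x + t) * (exp (- a * of_real x) * w a x)"
      by (simp add: E_def exp_add exp_minus field_simps)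
    also have "\<dots> = E (x + t) + (LINT s:{0<..<x}|lebesgue. E (x + t) * (\<sigma> s * (exp (- a * of_real s) * w (- a) s)))"
      unfolding D1[OF x] by (simp add: distrib_left)
    also have "(\<lambda>s. E (x + t) * (\<sigma> s * (exp (- a * of_real s) * w (- a) s))) = (\<lambda>s. \<sigma> s * (w (- a) s * E (t + x - s)))"
      unfolding Ead(2) by (simp add: mult_ac add.commute)
    finally show "w a x * E t = E (x + t) + (LINT s:{0<..<x}|lebesgue. \<sigma> s * (w (- a) s * E (t + x - s)))" .
    have "w (- a) x * E t = E (t - x) * (exp (a * of_real x) * w (- a) x)"
      unfolding Ead(2) by (simp add: exp_minus field_simps)
    also have "\<dots> = (LINT s:{0<..<x}|lebesgue. E (t - x) * (\<sigma> s * (exp (a * of_real s) * w a s)))"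
      unfolding D2[OF x] by simp
    also have "(\<lambda>s. E (t - x) * (\<sigma> s * (exp (a * of_real s) * w a s))) = (\<lambda>s. \<sigma> s * (w a s * E (t - x + s)))"
      unfolding Ead(1) by (simp add: mult_ac)
    finally show "w (- a) x * E t = (LINT s:{0<..<x}|lebesgue. \<sigma> s * (w a s * E (t - x + s)))" .
  next
    have "bounded (w a ` {0..l})" "bounded (w (- a) ` {0..l})"
      by (intro compact_imp_bounded compact_continuous_image cw compact_Icc)+
    then obtain B1 B2 where B: "\<And>x. x \<in> {0..l} \<Longrightarrow> norm (w a x) \<le> B1" "\<And>x. x \<in> {0..l} \<Longrightarrow> norm (w (- a) x) \<le> B2"
      unfolding bounded_iff by blast
    show "\<exists>B. \<forall>x t. 0 \<le> x \<longrightarrow> x + \<bar>t\<bar> \<le> l \<longrightarrow> norm (w a x * E t) \<le> B \<and> norm (w (- a) x * E t) \<le> B"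
    proof (intro exI[of _ "max B1 B2 * norm k"] allI impI)
      fix x t :: real assume "0 \<le> x" "x + \<bar>t\<bar> \<le> l"
      then have "x \<in> {0..l}" by auto
      from B[OF this] show "norm (w a x * E t) \<le> max B1 B2 * norm k \<and> norm (w (- a) x * E t) \<le> max B1 B2 * norm k"
        by (auto simp: norm_mult normE intro!: mult_right_mono)
    qed
  qed
  then show ?thesis
    by (intro that) (auto simp: \<sigma>_def E_def[abs_def] a_def w_def field_simps)
qed

section \<open>Density of exponentials with nonzero real frequencies\<close>

text \<open>The inductive form gives an induction rule whose two cases match the closure assumptions
  on \<open>A\<close> in \<open>exponential_dense\<close>.\<close>

inductive_set trig_poly :: "real \<Rightarrow> (real \<Rightarrow> complex) set" for \<omega> :: real where
  monomial: "(\<lambda>t. c * exp (\<i> * of_real (of_int k * \<omega>) * of_real t)) \<in> trig_poly \<omega>"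
| sum: "p \<in> trig_poly \<omega> \<Longrightarrow> q \<in> trig_poly \<omega> \<Longrightarrow> (\<lambda>t. p t + q t) \<in> trig_poly \<omega>"

text \<open>Frequencies add under multiplication, so trigonometric polynomials form an algebra, as
  Stone-Weierstrass requires.\<close>

lemma trig_poly_mult:
  assumes "p \<in> trig_poly \<omega>" "q \<in> trig_poly \<omega>"
  shows "(\<lambda>t. p t * q t) \<in> trig_poly \<omega>"
  using assms(1)
proof induction
  case (monomial c k)
  from assms(2) show ?case
  proof induction
    case (monomial c' k')
    have "(\<lambda>t. c * exp (\<i> * of_real (of_int k * \<omega>) * of_real t) * (c' * exp (\<i> * of_real (of_int k' * \<omega>) * of_real t)))
      = (\<lambda>t. (c * c') * exp (\<i> * of_real (of_int (k + k') * \<omega>) * of_real t))"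
      by (auto simp: exp_add[symmetric] algebra_simps)
    then show ?case using trig_poly.monomial[of "c * c'" "k + k'" \<omega>] by simp
  next
    case (sum p q)
    then show ?case using trig_poly.sum[OF sum.IH] by (simp add: distrib_left)
  qed
next
  case (sum p q)
  then show ?case using trig_poly.sum[OF sum.IH] by (simp add: distrib_right)
qed

lemma trig_poly_const: "(\<lambda>t. c) \<in> trig_poly \<omega>"
  using trig_poly.monomial[of c 0 \<omega>] by simp

lemma continuous_on_trig_poly: "p \<in> trig_poly \<omega> \<Longrightarrow> continuous_on A p"
  by (induction rule: trig_poly.induct) (auto intro!: continuous_intros)

text \<open>Stone-Weierstrass for the real-valued trigonometric polynomials. With base frequency
  pi/(2l) the sine is injective on [-l,l] and separates points. Base frequency pi/l would identify
  the endpoints -l and l.\<close>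

lemma real_trig_poly_dense:
  fixes y :: "real \<Rightarrow> real"
  assumes l: "l > 0" and y: "continuous_on {-l..l} y" and \<epsilon>: "\<epsilon> > 0"
  obtains g where "(\<lambda>t. of_real (g t)) \<in> trig_poly (pi / (2 * l))" "\<And>t. t \<in> {-l..l} \<Longrightarrow> \<bar>y t - g t\<bar> < \<epsilon>"
proof -
  define \<omega> where "\<omega> = pi / (2 * l)"
  have \<omega>0: "\<omega> \<ge> 0" using l by (simp add: \<omega>_def)
  define R where "R = {g. (\<lambda>t. complex_of_real (g t)) \<in> trig_poly \<omega>}"
  interpret function_ring_on R "{-l..l}"
  proof
    show "compact {-l..l}" by simp
    fix f assume f: "f \<in> R"
    then have "(\<lambda>t. complex_of_real (f t)) \<in> trig_poly \<omega>" by (simp add: R_def)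
    from continuous_on_Re[OF continuous_on_trig_poly[OF this]] show "continuous_on {-l..l} f" by simp
    fix g assume g: "g \<in> R"
    show "(\<lambda>x. f x + g x) \<in> R" using f g trig_poly.sum by (fastforce simp: R_def)
    show "(\<lambda>x. f x * g x) \<in> R" using f g trig_poly_mult by (fastforce simp: R_def)
  next
    show "(\<lambda>_. c) \<in> R" for c by (simp add: R_def trig_poly_const)
  next
    fix x y assume xy: "x \<in> {-l..l}" "y \<in> {-l..l}" "x \<noteq> y"
    have "(\<lambda>t. complex_of_real (sin (\<omega> * t))) =
      (\<lambda>t. (- \<i> / 2) * exp (\<i> * of_real (of_int 1 * \<omega>) * of_real t) + (\<i> / 2) * exp (\<i> * of_real (of_int (- 1) * \<omega>) * of_real t))"
      by (rule ext) (simp add: sin_of_real[symmetric] sin_exp_eq field_simps)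
    then have sin_R: "(\<lambda>t. sin (\<omega> * t)) \<in> R"
      unfolding R_def by (simp only: mem_Collect_eq trig_poly.intros)
    have "sin (\<omega> * x) \<noteq> sin (\<omega> * y)"
    proof
      assume "sin (\<omega> * x) = sin (\<omega> * y)"
      moreover have "- (pi / 2) \<le> \<omega> * t \<and> \<omega> * t \<le> pi / 2" if "t \<in> {-l..l}" for t
      proof -
        have "\<omega> * (-l) \<le> \<omega> * t" "\<omega> * t \<le> \<omega> * l"
          using that \<omega>0 by (intro mult_left_mono; simp)+
        moreover have "\<omega> * l = pi / 2" using l by (simp add: \<omega>_def)
        ultimately show ?thesis by simp
      qed
      ultimately have "\<omega> * x = \<omega> * y" using sin_inj_pi[of "\<omega> * x" "\<omega> * y"] xy by auto
      then show False using xy(3) l by (simp add: \<omega>_def)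
    qed
    then show "\<exists>f\<in>R. f x \<noteq> f y" by (rule bexI[OF _ sin_R])
  qed
  obtain g where "g \<in> R" "\<forall>x\<in>{-l..l}. \<bar>y x - g x\<bar> < \<epsilon>"
    using Stone_Weierstrass_basic[OF y \<epsilon>] by blast
  then show ?thesis using that by (auto simp: R_def \<omega>_def)
qed

text \<open>The frequencies are half-integer multiples of \<open>pi / (2 l)\<close>: the wave representation divides by
  the frequency, so the frequency 0 must be avoided.\<close>

lemma exponential_dense:
  fixes y :: "real \<Rightarrow> complex"
  assumes l: "l > 0" and y: "continuous_on {-l..l} y" and \<epsilon>: "\<epsilon> > 0"
    and exp: "\<And>c \<rho>. \<rho> \<noteq> 0 \<Longrightarrow> (\<lambda>t. c * exp (\<i> * of_real \<rho> * of_real t)) \<in> A"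
    and add: "\<And>p q. p \<in> A \<Longrightarrow> q \<in> A \<Longrightarrow> (\<lambda>t. p t + q t) \<in> A"
  obtains p where "p \<in> A" "\<And>t. t \<in> {-l..l} \<Longrightarrow> norm (y t - p t) < \<epsilon>"
proof -
  define \<omega> where "\<omega> = pi / (2 * l)"
  have \<omega>: "\<omega> \<noteq> 0" using l by (simp add: \<omega>_def)
  \<comment> \<open>Approximating y/E and multiplying back by \<open>E\<close> shifts each frequency
    k\<omega> to (k + 1/2)\<omega>, which is never 0. Since |E| = 1, the error is unchanged.\<close>
  define E where "E t = exp (\<i> * of_real (\<omega> / 2) * complex_of_real t)" for t
  have E: "E t \<noteq> 0" "norm (E t) = 1" for t by (simp_all add: E_def)
  define q where "q t = y t / E t" for t
  have q: "continuous_on {-l..l} q"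
    unfolding q_def E_def by (intro continuous_intros y) auto
  have e2: "\<epsilon> / 2 > 0" using \<epsilon> by simp
  obtain g where g: "(\<lambda>t. of_real (g t)) \<in> trig_poly \<omega>" "\<And>t. t \<in> {-l..l} \<Longrightarrow> \<bar>Re (q t) - g t\<bar> < \<epsilon> / 2"
    using real_trig_poly_dense[OF l continuous_on_Re[OF q] e2] unfolding \<omega>_def by blast
  obtain h where h: "(\<lambda>t. of_real (h t)) \<in> trig_poly \<omega>" "\<And>t. t \<in> {-l..l} \<Longrightarrow> \<bar>Im (q t) - h t\<bar> < \<epsilon> / 2"
    using real_trig_poly_dense[OF l continuous_on_Im[OF q] e2] unfolding \<omega>_def by blast
  define r where "r t = of_real (g t) + \<i> * of_real (h t)" for t
  have "r \<in> trig_poly \<omega>"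
    unfolding r_def using trig_poly.sum[OF g(1) trig_poly_mult[OF trig_poly_const[of \<i>] h(1)]] .
  then have "(\<lambda>t. r t * E t) \<in> A"
  proof induction
    case (monomial c k)
    have eq: "of_int k * \<omega> + \<omega> / 2 = (2 * of_int k + 1) * (\<omega> / 2)" by (simp add: field_simps)
    have "(2 * of_int k + 1 :: real) \<noteq> 0"
    proof -
      have "2 * k + 1 \<noteq> 0" by presburger
      then have "real_of_int (2 * k + 1) \<noteq> 0" by (simp only: of_int_eq_0_iff not_False_eq_True)
      then show ?thesis by simp
    qed
    then have "of_int k * \<omega> + \<omega> / 2 \<noteq> 0" using \<omega> unfolding eq by simp
    from exp[OF this, of c] show ?case
      by (simp add: E_def exp_add[symmetric] algebra_simps)
  next
    case (sum p q)
    from add[OF sum.IH] show ?case by (simp add: distrib_right)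
  qed
  moreover have "norm (y t - r t * E t) < \<epsilon>" if "t \<in> {-l..l}" for t
  proof -
    have "y t - r t * E t = (q t - r t) * E t" using E(1)[of t] by (simp add: q_def field_simps)
    then have "norm (y t - r t * E t) = norm (q t - r t)" by (simp add: norm_mult E)
    also have "\<dots> \<le> \<bar>Re (q t - r t)\<bar> + \<bar>Im (q t - r t)\<bar>" by (rule cmod_le)
    also have "\<dots> < \<epsilon>" using g(2)[OF that] h(2)[OF that] by (simp add: r_def)
    finally show ?thesis .
  qed
  ultimately show ?thesis by (rule that)
qed

section \<open>The operator \<open>T_f\<close> at a fixed point\<close>

lemma set_integrable_kernel:
  assumes K: "transmutation_kernel l e K" and x: "x \<in> {0..l}"
  shows "set_integrable lebesgue {-x..x} (K x)"
proof -
  have "set_integrable lebesgue {-x<..<x} (K x)"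
  \<comment> \<open>The definition of the kernel gives the L2 property only for
    \<open>x > 0\<close>; at \<open>x = 0\<close> the open interval is empty.\<close>
  proof (cases "x = 0")
    case False
    with K x have "L2_on {-x<..<x} (K x)" by (auto simp: transmutation_kernel_def)
    then show ?thesis by (rule L2_on_imp_set_integrable) auto
  qed (simp add: set_integrable_def)
  then show ?thesis by (simp add: absolutely_integrable_on_def integrable_on_open_interval_real)
qed

lemma set_integrable_kernel_mult:
  assumes "transmutation_kernel l e K" "x \<in> {0..l}" "y \<in> C_on (-l) l"
  shows "set_integrable lebesgue {-x..x} (\<lambda>t. K x t * y t)"
  by (rule set_integrable_mult_continuous[OF set_integrable_kernel[OF assms(1,2)], of "-l" l])
     (use assms in \<open>auto simp: C_on_def\<close>)

lemma T_f_linear: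
  assumes K: "transmutation_kernel l e K" and x: "x \<in> {0..l}"
    and y: "y \<in> C_on (-l) l" and z: "z \<in> C_on (-l) l"
  shows "T_f K (\<lambda>t. a * y t + b * z t) x = a * T_f K y x + b * T_f K z x"
proof -
  have "(LINT t:{-x..x}|lebesgue. K x t * (a * y t + b * z t)) =
    (LINT t:{-x..x}|lebesgue. a * (K x t * y t) + b * (K x t * z t))"
    by (simp add: algebra_simps)
  also have "\<dots> = a * (LINT t:{-x..x}|lebesgue. K x t * y t) + b * (LINT t:{-x..x}|lebesgue. K x t * z t)"
    by (subst set_integral_add(2))
       (auto intro!: set_integrable_mult_right set_integrable_kernel_mult[OF K x] y z)
  finally show ?thesis by (simp add: T_f_def algebra_simps)
qed

text \<open>For \<open>x > 0\<close> this is the defining property of the kernel. At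
  \<open>x = 0\<close>, which that property does not cover, the integral over a single point
  vanishes and \<open>e0\<close> gives the value.\<close>

lemma T_f_exp:
  assumes K: "transmutation_kernel l e K" and x: "x \<in> {0..l}" and e0: "e \<rho> 0 = 1"
  shows "T_f K (\<lambda>t. c * exp (\<i> * \<rho> * of_real t)) x = c * e \<rho> x"
proof (cases "x = 0")
  case True
  have "AE t in lebesgue. t \<noteq> (0::real)" by (rule AE_completion[OF AE_lborel_singleton])
  then have "AE t in lebesgue. indicator {- 0..0::real} t *\<^sub>R F t = 0" for F :: "real \<Rightarrow> complex"
    by eventually_elim (simp add: indicator_def)
  then have "(LINT t:{- 0..0::real}|lebesgue. F t) = 0" for F :: "real \<Rightarrow> complex"
    unfolding set_lebesgue_integral_def by (rule integral_eq_zero_AE)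
  with True show ?thesis by (simp add: T_f_def e0)
next
  case False
  let ?E = "\<lambda>t. exp (\<i> * \<rho> * complex_of_real t)"
  have "(LINT t:{-x..x}|lebesgue. K x t * (c * ?E t)) = (LINT t:{-x..x}|lebesgue. c * (K x t * ?E t))"
    by (simp only: mult.left_commute)
  also have "\<dots> = c * (LINT t:{-x..x}|lebesgue. K x t * ?E t)" by (rule set_integral_mult_right)
  finally show ?thesis
    using False K x by (simp add: T_f_def transmutation_kernel_def distrib_left)
qed

text \<open>The factor depends on \<open>x\<close>, with no uniformity claimed. It serves to pass to
  limits in \<open>y\<close> at a fixed \<open>x\<close>.\<close>

lemma norm_T_f_le_pointwise:
  assumes K: "transmutation_kernel l e K" and x: "x \<in> {0..l}" and y: "y \<in> C_on (-l) l"
    and P: "\<And>t. t \<in> {-l..l} \<Longrightarrow> norm (y t) \<le> P"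
  shows "norm (T_f K y x) \<le> P * (1 + (LINT t:{-x..x}|lebesgue. norm (K x t)))"
proof -
  have iK: "set_integrable lebesgue {-x..x} (\<lambda>t. norm (K x t))"
    by (intro set_integrable_norm set_integrable_kernel[OF K x])
  have i: "set_integrable lebesgue {-x..x} (\<lambda>t. K x t * y t)"
    by (rule set_integrable_kernel_mult[OF K x y])
  have "norm (LINT t:{-x..x}|lebesgue. K x t * y t) \<le> (LINT t:{-x..x}|lebesgue. norm (K x t * y t))"
    using i by (rule set_integral_norm_bound)
  also have "\<dots> \<le> (LINT t:{-x..x}|lebesgue. P * norm (K x t))"
  proof (rule set_integral_mono[OF set_integrable_norm[OF i]])
    show "set_integrable lebesgue {-x..x} (\<lambda>t. P * norm (K x t))"
      using iK by (intro set_integrable_mult_right)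
    fix t assume "t \<in> {-x..x}"
    then have "norm (y t) \<le> P" using x by (intro P) auto
    from mult_left_mono[OF this norm_ge_zero[of "K x t"]]
    show "norm (K x t * y t) \<le> P * norm (K x t)" by (simp add: norm_mult mult_ac)
  qed
  finally have "norm (LINT t:{-x..x}|lebesgue. K x t * y t) \<le> P * (LINT t:{-x..x}|lebesgue. norm (K x t))"
    by simp
  moreover have "norm (y x) \<le> P" using x by (intro P) auto
  ultimately show ?thesis unfolding T_f_def distrib_left mult_1_right
    by (rule norm_triangle_mono[rotated])
qed

section \<open>Extension by density to all continuous functions\<close>

text \<open>The wave estimate gives one constant for a dense class. Continuity in \<open>y\<close>
  at each fixed \<open>x\<close> carries the bound to every continuous \<open>y\<close> with the
  same constant. The bound then turns uniform approximation of \<open>y\<close> into uniform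
  approximation of \<open>T_f K y\<close>, so continuity in \<open>x\<close> survives the
  limit.\<close>

lemma T_f_bounded_continuous:
  assumes l: "l > 0" and f: "f \<in> W12 l" "\<forall>x\<in>{0..l}. f x \<noteq> 0"
    and e: "\<forall>\<rho>. is_e_f l f \<rho> (e \<rho>)" and K: "transmutation_kernel l e K"
  obtains C where
    "\<And>y P x. y \<in> C_on (-l) l \<Longrightarrow> (\<And>t. t \<in> {-l..l} \<Longrightarrow> norm (y t) \<le> P) \<Longrightarrow> x \<in> {0..l} \<Longrightarrow>
      norm (T_f K y x) \<le> C * P"
    "\<And>y. y \<in> C_on (-l) l \<Longrightarrow> continuous_on {0..l} (T_f K y)"
proof -
  define \<sigma> where "\<sigma> = log_deriv l f"
  have \<sigma>: "L2_on {0<..<l} \<sigma>" unfolding \<sigma>_def by (rule L2_on_log_deriv[OF f])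
  obtain C where C: "\<And>p U V P x. wave_solution l \<sigma> p U V \<Longrightarrow> (\<And>t. t \<in> {-l..l} \<Longrightarrow> norm (p t) \<le> P) \<Longrightarrow>
    x \<in> {0..l} \<Longrightarrow> norm (U x 0 + V x 0) \<le> C * P"
    by (rule wave_solution_bound[OF \<sigma> less_imp_le[OF l]]) blast
  \<comment> \<open>The functions whose image is continuous and represented by a wave solution.
    Closure under sums and the exponentials in \<open>A\<close> make it dense.\<close>
  define A where "A = {p. p \<in> C_on (-l) l \<and> continuous_on {0..l} (T_f K p) \<and>
    (\<exists>U V. wave_solution l \<sigma> p U V \<and> (\<forall>x\<in>{0..l}. T_f K p x = U x 0 + V x 0))}"
  have A_add: "(\<lambda>t. p t + q t) \<in> A" if p: "p \<in> A" and q: "q \<in> A" for p q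
  proof -
    from p q have pq: "p \<in> C_on (-l) l" "q \<in> C_on (-l) l"
      "continuous_on {0..l} (T_f K p)" "continuous_on {0..l} (T_f K q)" by (auto simp: A_def)
    from p obtain U V where UV: "wave_solution l \<sigma> p U V" "\<forall>x\<in>{0..l}. T_f K p x = U x 0 + V x 0"
      unfolding A_def by blast
    from q obtain U' V' where UV': "wave_solution l \<sigma> q U' V'" "\<forall>x\<in>{0..l}. T_f K q x = U' x 0 + V' x 0"
      unfolding A_def by blast
    have T: "T_f K (\<lambda>t. p t + q t) x = T_f K p x + T_f K q x" if "x \<in> {0..l}" for x
      using T_f_linear[OF K that pq(1,2), of 1 1] by simp
    have "continuous_on {0..l} (T_f K (\<lambda>t. p t + q t))"
      using continuous_on_add[OF pq(3,4)] by (rule continuous_on_eq) (simp add: T)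
    moreover have "(\<lambda>t. p t + q t) \<in> C_on (-l) l"
      using pq(1,2) by (auto simp: C_on_def intro: continuous_on_add)
    moreover have "\<forall>x\<in>{0..l}. T_f K (\<lambda>t. p t + q t) x = (U x 0 + U' x 0) + (V x 0 + V' x 0)"
      using T UV(2) UV'(2) by simp
    ultimately show ?thesis
      unfolding A_def using wave_solution_add[OF UV(1) UV'(1)] by blast
  qed
  have A_exp: "(\<lambda>t. c * exp (\<i> * of_real \<rho> * of_real t)) \<in> A" if \<rho>: "\<rho> \<noteq> 0" for c and \<rho> :: real
  proof -
    have e\<rho>: "is_e_f l f (of_real \<rho>) (e (of_real \<rho>))" using e by blast
    have ce: "continuous_on {0..l} (e (of_real \<rho>))"
      using e\<rho> by (auto simp: is_e_f_def dom_S_def W12_def)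
    have T: "T_f K (\<lambda>t. c * exp (\<i> * of_real \<rho> * of_real t)) x = c * e (of_real \<rho>) x" if "x \<in> {0..l}" for x
      using e\<rho> by (intro T_f_exp[OF K that]) (simp add: is_e_f_def)
    obtain U V where UV: "wave_solution l \<sigma> (\<lambda>t. c * exp (\<i> * of_real \<rho> * of_real t)) U V"
      "\<And>x. U x 0 + V x 0 = c * e (of_real \<rho>) x"
      unfolding \<sigma>_def by (rule e_f_wave_solution[OF f e\<rho> \<rho>]) blast
    have "continuous_on {0..l} (\<lambda>x. c * e (of_real \<rho>) x)" by (intro continuous_intros ce)
    then have "continuous_on {0..l} (T_f K (\<lambda>t. c * exp (\<i> * of_real \<rho> * of_real t)))"
      by (rule continuous_on_eq) (simp add: T)
    moreover have "(\<lambda>t. c * exp (\<i> * of_real \<rho> * of_real t)) \<in> C_on (-l) l"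
      unfolding C_on_def by (auto intro!: continuous_intros)
    moreover have "\<forall>x\<in>{0..l}. T_f K (\<lambda>t. c * exp (\<i> * of_real \<rho> * of_real t)) x = U x 0 + V x 0"
      using T UV(2) by simp
    ultimately show ?thesis unfolding A_def using UV(1) by blast
  qed
  have dense: "\<exists>p\<in>A. \<forall>t\<in>{-l..l}. norm (y t - p t) < \<epsilon>"
    if y: "y \<in> C_on (-l) l" and \<epsilon>: "\<epsilon> > 0" for y \<epsilon>
  proof -
    have "continuous_on {-l..l} y" using y by (simp add: C_on_def)
    then obtain p where "p \<in> A" "\<And>t. t \<in> {-l..l} \<Longrightarrow> norm (y t - p t) < \<epsilon>"
      by (rule exponential_dense[OF l _ \<epsilon> A_exp A_add]; blast)
    then show ?thesis by blast
  qed
  have A_bound: "norm (T_f K p x) \<le> C * P"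
    if "p \<in> A" "\<And>t. t \<in> {-l..l} \<Longrightarrow> norm (p t) \<le> P" "x \<in> {0..l}" for p P x
  proof -
    from that(1) obtain U V where UV: "wave_solution l \<sigma> p U V" "\<forall>x\<in>{0..l}. T_f K p x = U x 0 + V x 0"
      unfolding A_def by blast
    show ?thesis using C[OF UV(1) that(2,3)] UV(2) that(3) by simp
  qed
  have diff: "(\<lambda>t. y t - p t) \<in> C_on (-l) l"
    "x \<in> {0..l} \<Longrightarrow> T_f K (\<lambda>t. y t - p t) x = T_f K y x - T_f K p x"
    if "y \<in> C_on (-l) l" "p \<in> A" for y p x
  proof -
    have p: "p \<in> C_on (-l) l" using that(2) by (simp add: A_def)
    show "(\<lambda>t. y t - p t) \<in> C_on (-l) l" using that(1) p by (auto simp: C_on_def intro: continuous_on_diff)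
    show "T_f K (\<lambda>t. y t - p t) x = T_f K y x - T_f K p x" if "x \<in> {0..l}"
      using T_f_linear[OF K that \<open>y \<in> _\<close> p, of 1 "-1"] by simp
  qed
  have bound: "norm (T_f K y x) \<le> C * P"
    if y: "y \<in> C_on (-l) l" and P: "\<And>t. t \<in> {-l..l} \<Longrightarrow> norm (y t) \<le> P" and x: "x \<in> {0..l}" for y P x
  proof (rule field_le_epsilon)
    fix \<delta> :: real assume \<delta>: "\<delta> > 0"
    define D where "D = C + (1 + (LINT t:{-x..x}|lebesgue. norm (K x t)))"
    \<comment> \<open>\<open>D\<close> collects the coefficients of the approximation error. Its
      sign is unknown because \<open>C\<close> may be any real, hence the absolute value; adding 1
      avoids division by 0.\<close>
    define \<epsilon> where "\<epsilon> = \<delta> / (\<bar>D\<bar> + 1)"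
    have \<epsilon>: "\<epsilon> > 0" using \<delta> by (simp add: \<epsilon>_def)
    obtain p where p: "p \<in> A" "\<And>t. t \<in> {-l..l} \<Longrightarrow> norm (y t - p t) < \<epsilon>"
      using dense[OF y \<epsilon>] by blast
    have "norm (p t) \<le> P + \<epsilon>" if "t \<in> {-l..l}" for t
      using norm_triangle_ineq3[of "p t" "y t"] norm_triangle_ineq2[of "p t" "y t"] P[OF that] p(2)[OF that]
      by (simp add: norm_minus_commute)
    then have 1: "norm (T_f K p x) \<le> C * (P + \<epsilon>)" by (rule A_bound[OF p(1) _ x])
    have 2: "norm (T_f K y x - T_f K p x) \<le> \<epsilon> * (1 + (LINT t:{-x..x}|lebesgue. norm (K x t)))"
      using norm_T_f_le_pointwise[OF K x diff(1)[OF y p(1)] less_imp_le[OF p(2)]] diff(2)[OF y p(1) x] by simp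
    have "norm (T_f K y x) \<le> norm (T_f K p x) + norm (T_f K y x - T_f K p x)"
      by (metis add.commute diff_add_cancel norm_triangle_ineq)
    also have "\<dots> \<le> C * P + \<epsilon> * D" using 1 2 by (simp add: D_def algebra_simps)
    also have "\<epsilon> * D \<le> \<delta>"
    proof -
      have "\<epsilon> * D \<le> \<epsilon> * (\<bar>D\<bar> + 1)" using \<epsilon> by (intro mult_left_mono) auto
      also have "\<dots> = \<delta>" by (simp add: \<epsilon>_def)
      finally show ?thesis .
    qed
    finally show "norm (T_f K y x) \<le> C * P + \<delta>" by simp
  qed
  have cont: "continuous_on {0..l} (T_f K y)" if y: "y \<in> C_on (-l) l" for y
  proof -
    have "\<exists>p\<in>A. \<forall>t\<in>{-l..l}. norm (y t - p t) < 1 / real (Suc n)" for n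
      by (rule dense[OF y]) simp
    then obtain p where p: "\<And>n. p n \<in> A" "\<And>n t. t \<in> {-l..l} \<Longrightarrow> norm (y t - p n t) < 1 / real (Suc n)"
      by metis
    \<comment> \<open>The extended bound is applied to \<open>y - p n\<close>, which need not lie in
      \<open>A\<close>; hence the bound comes before continuity.\<close>
    have le: "norm (T_f K y x - T_f K (p n) x) \<le> C * (1 / real (Suc n))" if "x \<in> {0..l}" for n x
      using bound[OF diff(1)[OF y p(1)] less_imp_le[OF p(2)] that] diff(2)[OF y p(1) that] by simp
    have "uniform_limit {0..l} (\<lambda>n. T_f K (p n)) (T_f K y) sequentially"
    proof (rule uniform_limitI)
      fix \<epsilon> :: real assume "\<epsilon> > 0"
      have "(\<lambda>n. C * (1 / real (Suc n))) \<longlonglongrightarrow> C * 0"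
        by (intro tendsto_mult tendsto_const) (use LIMSEQ_inverse_real_of_nat in \<open>simp add: inverse_eq_divide\<close>)
      then have "\<forall>\<^sub>F n in sequentially. C * (1 / real (Suc n)) < \<epsilon>"
        using \<open>\<epsilon> > 0\<close> by (intro order_tendstoD(2)) auto
      then show "\<forall>\<^sub>F n in sequentially. \<forall>x\<in>{0..l}. dist (T_f K (p n) x) (T_f K y x) < \<epsilon>"
      proof eventually_elim
        case (elim n)
        then show ?case using le_less_trans[OF le] by (metis dist_commute dist_norm)
      qed
    qed
    then show ?thesis
      by (rule uniform_limit_theorem[rotated]) (use p(1) in \<open>auto simp: A_def\<close>)
  qed
  show ?thesis by (rule that[OF bound cont])
qed

theorem theorem27:
  fixes l :: real
    and f :: "real \<Rightarrow> complex"
    and e :: "complex \<Rightarrow> real \<Rightarrow> complex"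
    and K :: "real \<Rightarrow> real \<Rightarrow> complex"
  assumes "l > 0"
    and "f \<in> W12 l"
    and "\<forall>x\<in>{0..l}. f x \<noteq> 0"
    and "f 0 = 1"
    and "\<forall>\<rho>. is_e_f l f \<rho> (e \<rho>)"
    and "transmutation_kernel l e K"
  shows "T_f K ` C_on (-l) l \<subseteq> C_on 0 l \<and>
    (\<forall>y\<in>C_on (-l) l. \<forall>z\<in>C_on (-l) l. \<forall>a b. \<forall>x\<in>{0..l}.
       T_f K (\<lambda>t. a * y t + b * z t) x = a * T_f K y x + b * T_f K z x) \<and>
    (\<exists>M. \<forall>y\<in>C_on (-l) l. sup_norm 0 l (T_f K y) \<le> M * sup_norm (-l) l y)"
proof -
  obtain C where bound: "\<And>y P x. y \<in> C_on (-l) l \<Longrightarrow> (\<And>t. t \<in> {-l..l} \<Longrightarrow> norm (y t) \<le> P) \<Longrightarrow> x \<in> {0..l} \<Longrightarrow>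
      norm (T_f K y x) \<le> C * P"
    and cont: "\<And>y. y \<in> C_on (-l) l \<Longrightarrow> continuous_on {0..l} (T_f K y)"
    by (rule T_f_bounded_continuous[OF assms(1-3,5,6)]) blast
  have "sup_norm 0 l (T_f K y) \<le> C * sup_norm (-l) l y" if y: "y \<in> C_on (-l) l" for y
  proof -
    \<comment> \<open>A real \<open>SUP\<close> is an upper bound only for a set that is bounded
      above; compactness provides this.\<close>
    have "bdd_above ((\<lambda>t. norm (y t)) ` {-l..l})"
      using y unfolding C_on_def
      by (intro bounded_imp_bdd_above compact_imp_bounded compact_continuous_image continuous_on_norm) auto
    then have "norm (y t) \<le> sup_norm (-l) l y" if "t \<in> {-l..l}" for t
      unfolding sup_norm_def using that by (rule cSUP_upper[rotated])
    from bound[OF y this] show ?thesis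
      unfolding sup_norm_def[of 0] using assms(1) by (intro cSUP_least) auto
  qed
  then show ?thesis
    using cont T_f_linear[OF assms(6)] by (auto simp: C_on_def)
qed

end
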